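(* Let $P_{XY}$ be any joint distribution on (arbitrary) alphabets $\mathcal{X}$ and $\mathcal{Y}$. Then: 1) (Data processing inequality) If the Markov chain $X-Y-Z$ holds, then $\mathcal{L}(X\to Z)\le\min\{\mathcal{L}(X\to Y),\mathcal{L}(Y\to Z)\}$. 2) If $Y$ is discrete, then $\mathcal{L}(X\to Y)\le\log|\mathrm{supp}(Y)|$. 3) If $X$ is discrete, then $\mathcal{L}(X\to Y)\le\log|\mathrm{supp}(X)|$. 4) $\mathcal{L}(X\to Y)\ge0$, with equality if $X$ and $Y$ are independent.
   Context: $\log$ is the natural logarithm. Dashes denote Markov chains. The maximal leakage is $$\mathcal{L}(X\to Y)=\sup_{U-X-Y-\hat U}\log\frac{\Pr(U=\hat U)}{\max_{u\in\mathcal{U}}P_U(u)},$$ the supremum being over all $U,\hat U$ taking values in the same finite, but arbitrary, alphabet $\mathcal{U}$. For a discrete random variable, $\mathrm{supp}$ denotes the set of values of positive probability. *)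

theory Defs
  imports "HOL-Probability.Probability"
begin

text \<open>
  Alphabets are arbitrary measurable spaces; random variables are measurable maps from a
  probability space into them.  The sigma-algebra generated by \<open>B\<close> is
  \<open>vimage_algebra (space M) B MB\<close>.
\<close>

definition cond_indep_var ::
  "'w measure \<Rightarrow> 'a measure \<Rightarrow> ('w \<Rightarrow> 'a) \<Rightarrow> 'b measure \<Rightarrow> ('w \<Rightarrow> 'b)
    \<Rightarrow> 'c measure \<Rightarrow> ('w \<Rightarrow> 'c) \<Rightarrow> bool"
  \<comment> \<open>\<open>A\<close> and \<open>C\<close> are conditionally independent given \<open>B\<close>\<close>
  where "cond_indep_var M MA A MB B MC C \<longleftrightarrow>
    (\<forall>S\<in>sets MA. \<forall>T\<in>sets MC. AE \<omega> in M.
      real_cond_exp M (vimage_algebra (space M) B MB)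
          (indicator (A -` S \<inter> C -` T \<inter> space M)) \<omega> =
        real_cond_exp M (vimage_algebra (space M) B MB) (indicator (A -` S \<inter> space M)) \<omega> *
        real_cond_exp M (vimage_algebra (space M) B MB) (indicator (C -` T \<inter> space M)) \<omega>)"

definition markov_chain3 ::
  "'w measure \<Rightarrow> 'a measure \<Rightarrow> ('w \<Rightarrow> 'a) \<Rightarrow> 'b measure \<Rightarrow> ('w \<Rightarrow> 'b)
    \<Rightarrow> 'c measure \<Rightarrow> ('w \<Rightarrow> 'c) \<Rightarrow> bool"
  where "markov_chain3 M MA A MB B MC C \<longleftrightarrow> cond_indep_var M MA A MB B MC C"

text \<open>\<open>indep_var\<close> only covers variables with values in the same type.\<close>

definition indep_rv ::
  "'w measure \<Rightarrow> 'a measure \<Rightarrow> ('w \<Rightarrow> 'a) \<Rightarrow> 'b measure \<Rightarrow> ('w \<Rightarrow> 'b) \<Rightarrow> bool"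
  where "indep_rv M MX X MY Y \<longleftrightarrow> prob_space.indep_set M
    {X -` S \<inter> space M | S. S \<in> sets MX} {Y -` T \<inter> space M | T. T \<in> sets MY}"

text \<open>At each interior position the past and the future are independent given the present.\<close>

definition markov_chain4 ::
  "'w measure \<Rightarrow> 'a measure \<Rightarrow> ('w \<Rightarrow> 'a) \<Rightarrow> 'b measure \<Rightarrow> ('w \<Rightarrow> 'b)
    \<Rightarrow> 'c measure \<Rightarrow> ('w \<Rightarrow> 'c) \<Rightarrow> 'd measure \<Rightarrow> ('w \<Rightarrow> 'd) \<Rightarrow> bool"
  where "markov_chain4 M MA A MB B MC C MD D \<longleftrightarrow>
    cond_indep_var M MA A MB B (MC \<Otimes>\<^sub>M MD) (\<lambda>\<omega>. (C \<omega>, D \<omega>)) \<and>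
    cond_indep_var M (MA \<Otimes>\<^sub>M MB) (\<lambda>\<omega>. (A \<omega>, B \<omega>)) MC C MD D"

text \<open>Extended natural logarithm, with \<open>log 0 = -\<infinity>\<close> (whereas \<open>ln 0 = 0\<close> on the reals).\<close>

definition elog :: "ennreal \<Rightarrow> ereal"
  where "elog x = (if x = 0 then -\<infinity> else if x = \<infinity> then \<infinity> else ereal (ln (enn2real x)))"

text \<open>
  The auxiliary pair in the definition of leakage may need more randomness than a given
  space carrying \<open>X\<close> and \<open>Y\<close> provides, so the supremum ranges over joint laws of
  \<open>(U, X, Y, \<hat>U)\<close> whose \<open>(X, Y)\<close>-marginal is the given \<open>P\<close>.  Up to relabelling,
  a finite alphabet is a finite nonempty set \<open>A\<close> of natural numbers.
\<close>

definition leakage_laws ::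
  "'a measure \<Rightarrow> 'b measure \<Rightarrow> ('a \<times> 'b) measure \<Rightarrow> nat set \<Rightarrow> (nat \<times> 'a \<times> 'b \<times> nat) measure set"
  where "leakage_laws MX MY P A = {Q.
    prob_space Q \<and>
    sets Q = sets (count_space A \<Otimes>\<^sub>M MX \<Otimes>\<^sub>M MY \<Otimes>\<^sub>M count_space A) \<and>
    distr Q (MX \<Otimes>\<^sub>M MY) (\<lambda>(u, x, y, v). (x, y)) = P \<and>
    markov_chain4 Q (count_space A) (\<lambda>(u, x, y, v). u) MX (\<lambda>(u, x, y, v). x)
      MY (\<lambda>(u, x, y, v). y) (count_space A) (\<lambda>(u, x, y, v). v)}"

definition guessing_gain :: "nat set \<Rightarrow> (nat \<times> 'a \<times> 'b \<times> nat) measure \<Rightarrow> ereal"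
  where "guessing_gain A Q = elog (ennreal
    (measure Q {(u, x, y, v) \<in> space Q. u = v} /
     Max ((\<lambda>a. measure Q {(u, x, y, v) \<in> space Q. u = a}) ` A)))"

definition leakage_of_law :: "'a measure \<Rightarrow> 'b measure \<Rightarrow> ('a \<times> 'b) measure \<Rightarrow> ereal"
  where "leakage_of_law MX MY P =
    Sup {guessing_gain A Q | A Q. finite A \<and> A \<noteq> {} \<and> Q \<in> leakage_laws MX MY P A}"

definition maximal_leakage ::
  "'w measure \<Rightarrow> 'a measure \<Rightarrow> ('w \<Rightarrow> 'a) \<Rightarrow> 'b measure \<Rightarrow> ('w \<Rightarrow> 'b) \<Rightarrow> ereal"
  where "maximal_leakage M MX X MY Y =
    leakage_of_law MX MY (distr M (MX \<Otimes>\<^sub>M MY) (\<lambda>\<omega>. (X \<omega>, Y \<omega>)))"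

definition discrete_rv :: "'w measure \<Rightarrow> 'a measure \<Rightarrow> ('w \<Rightarrow> 'a) \<Rightarrow> bool"
  where "discrete_rv M MX X \<longleftrightarrow>
    (\<exists>S. countable S \<and> (\<forall>x\<in>S. {x} \<in> sets MX) \<and> (AE \<omega> in M. X \<omega> \<in> S))"

definition rv_supp :: "'w measure \<Rightarrow> ('w \<Rightarrow> 'a) \<Rightarrow> 'a set"
  where "rv_supp M X = {x. measure M (X -` {x} \<inter> space M) > 0}"

definition log_card :: "'a set \<Rightarrow> ereal"
  \<comment> \<open>counting measure rather than \<open>card\<close>, so that infinite sets have size \<open>\<infinity>\<close>\<close>
  where "log_card S = elog (emeasure (count_space UNIV) S)"

end

theory Submission
  imports Defs
begin

text \<open>
  Write \<open>V\<close> for the guess. Since \<open>U\<close> and \<open>V\<close> are finite-valued, the probabilities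
  \<open>Pr(U = V)\<close> and \<open>Pr(U = a)\<close> under \<open>U - X - Y - V\<close> are determined by the law of
  \<open>(X, Y)\<close> and the measurable functions \<open>p\<^sub>a(X) = Pr(U = a | X)\<close>, \<open>q\<^sub>a(Y) = Pr(V = a | Y)\<close>, so the
  leakage is the supremum of \<open>log (\<Sum>\<^sub>a E[p\<^sub>a(X) q\<^sub>a(Y)] / max\<^sub>a E[p\<^sub>a(X)])\<close> over all such families.
  No regular conditional distributions are involved, hence no restriction on the alphabets.
  Data processing then amounts to replacing \<open>q\<^sub>a(Z)\<close> by \<open>E[q\<^sub>a(Z) | Y]\<close>, or \<open>p\<^sub>a(X)\<close> by
  \<open>E[p\<^sub>a(X) | Y]\<close>; the cardinality bounds follow by summing over the support, using
  \<open>E[p\<^sub>a(X) 1{Y = y}] \<le> E[p\<^sub>a(X)]\<close> and \<open>Pr(X = x) p\<^sub>a(x) \<le> E[p\<^sub>a(X)]\<close> respectively.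
\<close>

section \<open>Conditional expectation given a random variable\<close>

text \<open>The definition of leakage lets the probability space vary with the auxiliary pair, while
  the Markov chain \<open>X - Y - Z\<close> and independence live on the fixed space
  \<open>M\<close>. Kernels bridge the two because they are functions on the alphabets: a
  conditional expectation given \<open>X\<close> factors as a measurable function of
  \<open>X\<close> (Doob-Dynkin), so it can be evaluated on either space, and its integrals see only
  the common law of \<open>(X, Y)\<close>. Two gaps have to be closed. Conditional probabilities are
  nonnegative and sum to one only almost everywhere; since there are finitely many letters, the
  exceptional set is measurable and the factors can be redefined on it. And conditional independence
  is given for events, whereas the computation needs it for \<open>p a (X \<omega>)\<close> and
  \<open>q a (Y \<omega>)\<close>; the passage compares image measures of weighted measures, which
  handles all measurable test functions at once. Conversely every pair of kernels must come from an
  admissible law. \<open>M\<close> may carry too little randomness for this, so the law is built on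
  \<open>M\<close> times a finite set of pairs of letters.\<close>

text \<open>Doob-Dynkin factorization, by induction over simple functions and monotone
  limits.\<close>

lemma borel_measurable_vimage_algebra_factor:
  fixes f :: "'w \<Rightarrow> ennreal"
  assumes "f \<in> borel_measurable (vimage_algebra \<Omega> B N)" and B: "B \<in> \<Omega> \<rightarrow> space N"
  shows "\<exists>g\<in>borel_measurable N. \<forall>\<omega>\<in>\<Omega>. f \<omega> = g (B \<omega>)"
  using assms(1)
proof (induction rule: borel_measurable_induct)
  case (cong f g)
  then obtain h where h: "h \<in> borel_measurable N" "\<forall>\<omega>\<in>\<Omega>. g \<omega> = h (B \<omega>)"
    by blast
  from cong(3) have "\<forall>\<omega>\<in>\<Omega>. f \<omega> = g \<omega>" unfolding space_vimage_algebra by blast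
  with h have "\<forall>\<omega>\<in>\<Omega>. f \<omega> = h (B \<omega>)" by metis
  with h(1) show ?case by blast
next
  case (set A)
  then obtain T where T: "T \<in> sets N" "A = B -` T \<inter> \<Omega>"
    unfolding sets_vimage_algebra2[OF B] by blast
  then have "indicator T \<in> borel_measurable N" by simp
  moreover have "\<forall>\<omega>\<in>\<Omega>. indicator A \<omega> = (indicator T (B \<omega>) :: ennreal)"
    unfolding T(2) by (simp add: indicator_def)
  ultimately show ?case by blast
next
  case (mult u c)
  then obtain g where g: "g \<in> borel_measurable N" "\<forall>\<omega>\<in>\<Omega>. u \<omega> = g (B \<omega>)" by blast
  then have "(\<lambda>x. c * g x) \<in> borel_measurable N" by simp
  moreover have "\<forall>\<omega>\<in>\<Omega>. c * u \<omega> = c * g (B \<omega>)" using g(2) by metis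
  ultimately show ?case by (rule bexI[rotated, where x = "\<lambda>x. c * g x"])
next
  case (add u v)
  then obtain g h where g: "g \<in> borel_measurable N" "\<forall>\<omega>\<in>\<Omega>. u \<omega> = g (B \<omega>)"
    and h: "h \<in> borel_measurable N" "\<forall>\<omega>\<in>\<Omega>. v \<omega> = h (B \<omega>)" by blast
  then have "(\<lambda>x. h x + g x) \<in> borel_measurable N" by simp
  moreover have "\<forall>\<omega>\<in>\<Omega>. v \<omega> + u \<omega> = h (B \<omega>) + g (B \<omega>)" using g(2) h(2) by metis
  ultimately show ?case by (rule bexI[rotated, where x = "\<lambda>x. h x + g x"])
next
  case (seq U)
  then have "\<forall>i. \<exists>g. g \<in> borel_measurable N \<and> (\<forall>\<omega>\<in>\<Omega>. U i \<omega> = g (B \<omega>))" by blast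
  then obtain g where g: "\<And>i. g i \<in> borel_measurable N"
    and U: "\<And>i \<omega>. \<omega> \<in> \<Omega> \<Longrightarrow> U i \<omega> = g i (B \<omega>)"
    by metis
  \<comment> \<open>Off the range of \<open>B\<close> the factors need not increase with
    \<open>i\<close>; in \<open>ennreal\<close> their supremum is still defined and measurable,
    which is why the lemma is stated for that type.\<close>
  have "(\<lambda>x. SUP i. g i x) \<in> borel_measurable N" using g by simp
  moreover have "\<forall>\<omega>\<in>\<Omega>. (SUP i. U i) \<omega> = (SUP i. g i (B \<omega>))"
    unfolding Sup_apply image_image using U by simp
  ultimately show ?case by (rule bexI[rotated, where x = "\<lambda>x. SUP i. g i x"])
qed

text \<open>\<open>real_cond_exp\<close> is a difference of two \<open>nn_cond_exp\<close>, each of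
  which factors. The identity holds at every point of the space because it concerns the chosen
  version itself.\<close>

lemma real_cond_exp_vimage_factor:
  assumes "B \<in> M \<rightarrow>\<^sub>M N"
  obtains g where "g \<in> borel_measurable N"
    "\<And>\<omega>. \<omega> \<in> space M \<Longrightarrow> real_cond_exp M (vimage_algebra (space M) B N) f \<omega> = g (B \<omega>)"
proof -
  let ?F = "vimage_algebra (space M) B N"
  have B: "B \<in> space M \<rightarrow> space N" using assms by (auto simp: measurable_def)
  have "\<exists>g\<in>borel_measurable N. \<forall>\<omega>\<in>space M. nn_cond_exp M ?F h \<omega> = g (B \<omega>)" for h
    by (rule borel_measurable_vimage_algebra_factor) (use B in auto)
  then obtain g1 g2 where g: "g1 \<in> borel_measurable N" "g2 \<in> borel_measurable N"
    "\<forall>\<omega>\<in>space M. nn_cond_exp M ?F (\<lambda>x. ennreal (f x)) \<omega> = g1 (B \<omega>)"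
    "\<forall>\<omega>\<in>space M. nn_cond_exp M ?F (\<lambda>x. ennreal (- f x)) \<omega> = g2 (B \<omega>)"
    by metis
  show ?thesis
  proof (rule that[of "\<lambda>x. enn2real (g1 x) - enn2real (g2 x)"])
    show "(\<lambda>x. enn2real (g1 x) - enn2real (g2 x)) \<in> borel_measurable N" using g by simp
  qed (use g in \<open>simp add: real_cond_exp_def\<close>)
qed

lemma (in prob_space) finite_measure_subalgebra_vimage:
  assumes "B \<in> M \<rightarrow>\<^sub>M N"
  shows "finite_measure_subalgebra M (vimage_algebra (space M) B N)"
proof
  have "B \<in> space M \<rightarrow> space N" using assms by (auto simp: measurable_def)
  then show "subalgebra M (vimage_algebra (space M) B N)"
    using assms by (auto simp: subalgebra_def sets_vimage_algebra2 intro: measurable_sets)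
qed

lemma (in prob_space) real_cond_exp_unit_interval:
  assumes B: "B \<in> M \<rightarrow>\<^sub>M N" and f[measurable]: "f \<in> borel_measurable M"
    and bd: "\<And>\<omega>. \<omega> \<in> space M \<Longrightarrow> 0 \<le> f \<omega> \<and> f \<omega> \<le> (1::real)"
  shows "AE \<omega> in M. 0 \<le> real_cond_exp M (vimage_algebra (space M) B N) f \<omega>"
    and "AE \<omega> in M. real_cond_exp M (vimage_algebra (space M) B N) f \<omega> \<le> 1"
proof -
  interpret F: finite_measure_subalgebra M "vimage_algebra (space M) B N"
    by (rule finite_measure_subalgebra_vimage[OF B])
  have int: "integrable M f"
    by (rule integrable_const_bound[where B=1]) (use bd in auto)
  show "AE \<omega> in M. 0 \<le> real_cond_exp M (vimage_algebra (space M) B N) f \<omega>"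
    by (rule F.real_cond_exp_pos) (use bd in auto)
  have "AE \<omega> in M. real_cond_exp M (vimage_algebra (space M) B N) f \<omega>
      \<le> real_cond_exp M (vimage_algebra (space M) B N) (\<lambda>_. 1) \<omega>"
    by (rule F.real_cond_exp_mono) (use bd int in auto)
  moreover have "AE \<omega> in M. real_cond_exp M (vimage_algebra (space M) B N) (\<lambda>_. 1) \<omega> = 1"
    by (rule F.real_cond_exp_F_meas) auto
  ultimately show "AE \<omega> in M. real_cond_exp M (vimage_algebra (space M) B N) f \<omega> \<le> 1"
    by eventually_elim simp
qed

section \<open>Finite kernels and conditional probabilities of finitely many letters\<close>

text \<open>A conditional law on the finite alphabet \<open>A\<close>. Nonnegativity and total mass
  one are required at every point, so that sums over letters can be evaluated at any argument and
  under any measure without tracking null sets.\<close>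

definition finite_kernel :: "'a measure \<Rightarrow> 'i set \<Rightarrow> ('i \<Rightarrow> 'a \<Rightarrow> real) \<Rightarrow> bool"
  where "finite_kernel N A p \<longleftrightarrow>
    (\<forall>a\<in>A. p a \<in> borel_measurable N \<and> (\<forall>x. 0 \<le> p a x)) \<and> (\<forall>x. (\<Sum>a\<in>A. p a x) = 1)"

lemma finite_kernel_measurable: "finite_kernel N A p \<Longrightarrow> a \<in> A \<Longrightarrow> p a \<in> borel_measurable N"
  and finite_kernel_nonneg: "finite_kernel N A p \<Longrightarrow> a \<in> A \<Longrightarrow> 0 \<le> p a x"
  and finite_kernel_sum: "finite_kernel N A p \<Longrightarrow> (\<Sum>a\<in>A. p a x) = 1"
  by (auto simp: finite_kernel_def)

lemma finite_kernel_le_1: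
  assumes "finite_kernel N A p" "finite A" "a \<in> A"
  shows "p a x \<le> 1"
  using member_le_sum[of a A "\<lambda>a. p a x"] assms by (auto simp: finite_kernel_def)

lemma (in prob_space) finite_kernel_expectation:
  assumes p: "finite_kernel N A p" and A: "finite A" and X[measurable]: "X \<in> M \<rightarrow>\<^sub>M N"
  shows "a \<in> A \<Longrightarrow> integrable M (\<lambda>\<omega>. p a (X \<omega>))"
    and "(\<Sum>a\<in>A. \<integral>\<omega>. p a (X \<omega>) \<partial>M) = 1"
proof -
  show int: "integrable M (\<lambda>\<omega>. p a (X \<omega>))" if a: "a \<in> A" for a
  proof (rule integrable_const_bound[where B=1])
    have [measurable]: "p a \<in> borel_measurable N" using p a by (rule finite_kernel_measurable)
    show "(\<lambda>\<omega>. p a (X \<omega>)) \<in> borel_measurable M" by measurable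
  qed (use finite_kernel_nonneg[OF p a] finite_kernel_le_1[OF p A a] in auto)
  have "(\<Sum>a\<in>A. \<integral>\<omega>. p a (X \<omega>) \<partial>M) = (\<integral>\<omega>. (\<Sum>a\<in>A. p a (X \<omega>)) \<partial>M)"
    using int by simp
  also have "\<dots> = 1" by (simp add: finite_kernel_sum[OF p] prob_space)
  finally show "(\<Sum>a\<in>A. \<integral>\<omega>. p a (X \<omega>) \<partial>M) = 1" .
qed

text \<open>Positivity and linearity of conditional expectation give the kernel properties almost
  everywhere, and with finitely many letters a single measurable correction makes them hold
  everywhere.\<close>

lemma (in prob_space) exists_conditional_kernel:
  assumes B[measurable]: "B \<in> M \<rightarrow>\<^sub>M N" and A: "finite A"
    and h[measurable]: "\<And>a. a \<in> A \<Longrightarrow> h a \<in> borel_measurable M"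
    and h0: "\<And>a \<omega>. a \<in> A \<Longrightarrow> \<omega> \<in> space M \<Longrightarrow> 0 \<le> h a \<omega>"
    and h1: "\<And>\<omega>. \<omega> \<in> space M \<Longrightarrow> (\<Sum>a\<in>A. h a \<omega>) = (1::real)"
  obtains p where "finite_kernel N A p"
    "\<And>a. a \<in> A \<Longrightarrow>
      AE \<omega> in M. real_cond_exp M (vimage_algebra (space M) B N) (h a) \<omega> = p a (B \<omega>)"
proof -
  let ?F = "vimage_algebra (space M) B N"
  interpret F: finite_measure_subalgebra M ?F
    by (rule finite_measure_subalgebra_vimage[OF B])
  have "\<exists>g. g \<in> borel_measurable N \<and>
      (\<forall>\<omega>\<in>space M. real_cond_exp M ?F (h a) \<omega> = g (B \<omega>))" for a
    by (rule real_cond_exp_vimage_factor[OF B, of "h a"]) blast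
  then obtain g where gm[measurable]: "\<And>a. g a \<in> borel_measurable N"
    and g: "\<And>a \<omega>. \<omega> \<in> space M \<Longrightarrow> real_cond_exp M ?F (h a) \<omega> = g a (B \<omega>)"
    by metis
  have "\<exists>\<omega>. \<omega> \<in> space M" using not_empty by blast
  \<comment> \<open>An empty \<open>A\<close> would make the sum of the \<open>h a\<close> equal to
    0 instead of 1.\<close>
  then obtain a0 where a0: "a0 \<in> A" using h1 by (metis equals0I sum.empty zero_neq_one)
  define good where "good x \<longleftrightarrow> (\<forall>a\<in>A. 0 \<le> g a x) \<and> (\<Sum>a\<in>A. g a x) = 1" for x
  \<comment> \<open>Where the factors fail to be a probability vector, the point mass at
    \<open>a0\<close> serves as default.\<close>
  define p where "p a x = (if good x then g a x else if a = a0 then 1 else 0)" for a x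
  have h_le: "h a \<omega> \<le> 1" if "a \<in> A" "\<omega> \<in> space M" for a \<omega>
    using member_le_sum[of a A "\<lambda>a. h a \<omega>"] h0 h1 A that by auto
  have int: "integrable M (h a)" if "a \<in> A" for a
    by (rule integrable_const_bound[where B=1]) (use h0 h_le that in auto)
  have [measurable]: "Measurable.pred N good"
    unfolding good_def using A by (intro pred_intros_logic pred_intros_finite) auto
  have ker: "finite_kernel N A p"
    unfolding finite_kernel_def
  proof (intro conjI ballI allI)
    show "p a \<in> borel_measurable N" for a unfolding p_def by measurable
    show "0 \<le> p a x" if "a \<in> A" for a x using that by (auto simp: p_def good_def)
    show "(\<Sum>a\<in>A. p a x) = 1" for x
    proof (cases "good x")
      case True
      then have "(\<Sum>a\<in>A. g a x) = 1" by (simp add: good_def)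
      then show ?thesis using True by (simp add: p_def)
    next
      case False
      then show ?thesis using A a0 by (simp add: p_def)
    qed
  qed
  have nonneg: "AE \<omega> in M. \<forall>a\<in>A. 0 \<le> real_cond_exp M ?F (h a) \<omega>"
    by (rule AE_finite_allI[OF A], rule real_cond_exp_unit_interval[OF B]) (use h0 h_le in auto)
  have "AE \<omega> in M. real_cond_exp M ?F (\<lambda>\<omega>. \<Sum>a\<in>A. h a \<omega>) \<omega> = (\<Sum>a\<in>A. real_cond_exp M ?F (h a) \<omega>)"
  proof -
    \<comment> \<open>\<open>real_cond_exp_sum\<close> asks for integrability at every index, so the
      family is extended by zero outside \<open>A\<close>.\<close>
    have "AE \<omega> in M. real_cond_exp M ?F (\<lambda>\<omega>. \<Sum>a\<in>A. if a \<in> A then h a \<omega> else 0) \<omega>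
        = (\<Sum>a\<in>A. real_cond_exp M ?F (\<lambda>\<omega>. if a \<in> A then h a \<omega> else 0) \<omega>)"
    proof (rule F.real_cond_exp_sum)
      show "integrable M (\<lambda>\<omega>. if a \<in> A then h a \<omega> else 0)" for a
        using int by (cases "a \<in> A") auto
    qed
    then show ?thesis by (simp cong: sum.cong)
  qed
  moreover have "AE \<omega> in M. real_cond_exp M ?F (\<lambda>\<omega>. \<Sum>a\<in>A. h a \<omega>) \<omega> = real_cond_exp M ?F (\<lambda>_. 1) \<omega>"
    by (rule F.real_cond_exp_cong) (use h1 in auto)
  moreover have "AE \<omega> in M. real_cond_exp M ?F (\<lambda>_. 1) \<omega> = 1"
    by (rule F.real_cond_exp_F_meas) auto
  ultimately have "AE \<omega> in M. (\<Sum>a\<in>A. real_cond_exp M ?F (h a) \<omega>) = 1"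
    by eventually_elim simp
  with nonneg AE_space have good: "AE \<omega> in M. good (B \<omega>)"
    by eventually_elim (simp add: good_def g)
  show ?thesis
  proof (rule that[OF ker])
    show "AE \<omega> in M. real_cond_exp M ?F (h a) \<omega> = p a (B \<omega>)" if "a \<in> A" for a
      using good AE_space by eventually_elim (simp add: p_def g)
  qed
qed

section \<open>Conditional independence for bounded functions\<close>

text \<open>The hypothesis says that the measures with densities \<open>a\<close> and
  \<open>b\<close> have the same image under \<open>X\<close>. Equal image measures integrate every
  measurable \<open>f\<close> alike, also when both Bochner integrals take their default value
  0.\<close>

lemma integral_weight_eq:
  fixes a b :: "'w \<Rightarrow> real" and f :: "'a \<Rightarrow> real"
  assumes X[measurable]: "X \<in> M \<rightarrow>\<^sub>M N"
    and a: "integrable M a" "AE \<omega> in M. 0 \<le> a \<omega>"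
    and b: "integrable M b" "AE \<omega> in M. 0 \<le> b \<omega>"
    and eq: "\<And>S. S \<in> sets N \<Longrightarrow>
      (\<integral>\<omega>. a \<omega> * indicator S (X \<omega>) \<partial>M) = (\<integral>\<omega>. b \<omega> * indicator S (X \<omega>) \<partial>M)"
    and f[measurable]: "f \<in> borel_measurable N"
  shows "(\<integral>\<omega>. a \<omega> * f (X \<omega>) \<partial>M) = (\<integral>\<omega>. b \<omega> * f (X \<omega>) \<partial>M)"
proof -
  have [measurable]: "a \<in> borel_measurable M" "b \<in> borel_measurable M" using a b by auto
  have em: "emeasure (distr (density M c) N X) S = ennreal (\<integral>\<omega>. c \<omega> * indicator S (X \<omega>) \<partial>M)"
    if c: "integrable M c" "AE \<omega> in M. 0 \<le> c \<omega>" and S[measurable]: "S \<in> sets N"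
    for c :: "'w \<Rightarrow> real" and S
  proof -
    have [measurable]: "c \<in> borel_measurable M" using c by auto
    have "integrable M (\<lambda>\<omega>. c \<omega> * indicator S (X \<omega>))"
      by (rule Bochner_Integration.integrable_bound[OF c(1)]) (auto simp: indicator_def)
    then have *: "(\<integral>\<^sup>+\<omega>. ennreal (c \<omega> * indicator S (X \<omega>)) \<partial>M)
        = ennreal (\<integral>\<omega>. c \<omega> * indicator S (X \<omega>) \<partial>M)"
      using c by (intro nn_integral_eq_integral) auto
    have "emeasure (distr (density M c) N X) S
        = (\<integral>\<^sup>+\<omega>. ennreal (c \<omega>) * indicator (X -` S \<inter> space M) \<omega> \<partial>M)"
      by (simp add: emeasure_distr emeasure_density)
    also have "\<dots> = (\<integral>\<^sup>+\<omega>. ennreal (c \<omega> * indicator S (X \<omega>)) \<partial>M)"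
      by (intro nn_integral_cong) (auto simp: indicator_def)
    finally show ?thesis using * by simp
  qed
  have "distr (density M a) N X = distr (density M b) N X"
    by (rule measure_eqI) (use em[OF a] em[OF b] eq in auto)
  moreover have "(\<integral>x. f x \<partial>distr (density M c) N X) = (\<integral>\<omega>. c \<omega> * f (X \<omega>) \<partial>M)"
    if c: "integrable M c" "AE \<omega> in M. 0 \<le> c \<omega>" for c :: "'w \<Rightarrow> real"
    using c by (subst integral_distr) (auto simp: integral_density)
  ultimately show ?thesis using a b by metis
qed

lemma cond_indep_var_commute:
  "cond_indep_var M MA A MB B MC C \<Longrightarrow> cond_indep_var M MC C MB B MA A"
  unfolding cond_indep_var_def by (simp add: Int_commute Int_left_commute mult.commute)

text \<open>Events are replaced by functions one side at a time, each time through
  \<open>integral_weight_eq\<close>: first the test function of \<open>C\<close>, with weights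
  \<open>f (A \<omega>)\<close> and its conditional expectation, then the test function of
  \<open>A\<close>, with weights \<open>i\<close> and its conditional expectation.\<close>

lemma (in prob_space) cond_indep_var_integral:
  fixes f :: "'b \<Rightarrow> real" and h :: "'d \<Rightarrow> real"
  assumes ci: "cond_indep_var M MA A MB B MC C"
    and A[measurable]: "A \<in> M \<rightarrow>\<^sub>M MA" and B: "B \<in> M \<rightarrow>\<^sub>M MB" and C[measurable]: "C \<in> M \<rightarrow>\<^sub>M MC"
    and f[measurable]: "f \<in> borel_measurable MA" and f01: "\<And>x. 0 \<le> f x \<and> f x \<le> 1"
    and h[measurable]: "h \<in> borel_measurable MC"
  shows "(\<integral>\<omega>. f (A \<omega>) * h (C \<omega>) \<partial>M) =
    (\<integral>\<omega>. real_cond_exp M (vimage_algebra (space M) B MB) (\<lambda>\<omega>. f (A \<omega>)) \<omega> * h (C \<omega>) \<partial>M)"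
proof -
  let ?F = "vimage_algebra (space M) B MB"
  let ?E = "real_cond_exp M ?F"
  interpret F: finite_measure_subalgebra M ?F
    by (rule finite_measure_subalgebra_vimage[OF B])
  have f_int: "integrable M (\<lambda>\<omega>. f (A \<omega>))"
    by (rule integrable_const_bound[where B=1]) (use f01 in auto)
  have f_E: "AE \<omega> in M. 0 \<le> ?E (\<lambda>\<omega>. f (A \<omega>)) \<omega>"
    by (rule real_cond_exp_unit_interval[OF B]) (use f01 in auto)
  show ?thesis
  proof (rule integral_weight_eq[OF C])
    fix T assume T[measurable]: "T \<in> sets MC"
    define i where "i = (indicator (C -` T \<inter> space M) :: 'a \<Rightarrow> real)"
    have i_eq: "i \<omega> = indicator T (C \<omega>)" if "\<omega> \<in> space M" for \<omega>
      using that by (simp add: i_def indicator_def)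
    have [measurable]: "i \<in> borel_measurable M" unfolding i_def by measurable
    have i01: "0 \<le> i \<omega> \<and> i \<omega> \<le> 1" for \<omega> by (simp add: i_def)
    have i_int: "integrable M i"
      by (rule integrable_const_bound[where B=1]) (use i01 in auto)
    note i_E = real_cond_exp_unit_interval[OF B \<open>i \<in> borel_measurable M\<close> i01]
    have prod_int: "integrable M (\<lambda>\<omega>. u \<omega> * v \<omega>)"
      if "integrable M u" "AE \<omega> in M. 0 \<le> v \<omega>" "AE \<omega> in M. v \<omega> \<le> 1" "v \<in> borel_measurable M"
      for u v :: "'a \<Rightarrow> real"
    proof (rule Bochner_Integration.integrable_bound[OF that(1)])
      show "(\<lambda>\<omega>. u \<omega> * v \<omega>) \<in> borel_measurable M"
        using that by (auto intro: borel_measurable_times)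
      show "AE \<omega> in M. norm (u \<omega> * v \<omega>) \<le> norm (u \<omega>)"
        using that(2,3) by eventually_elim (auto simp: abs_mult mult_left_le)
    qed
    have "(\<integral>\<omega>. i \<omega> * f (A \<omega>) \<partial>M) = (\<integral>\<omega>. ?E i \<omega> * f (A \<omega>) \<partial>M)"
    proof (rule integral_weight_eq[OF A])
      fix S assume S[measurable]: "S \<in> sets MA"
      define j where "j = (indicator (A -` S \<inter> space M) :: 'a \<Rightarrow> real)"
      have j_eq: "j \<omega> = indicator S (A \<omega>)" if "\<omega> \<in> space M" for \<omega>
        using that by (simp add: j_def indicator_def)
      have [measurable]: "j \<in> borel_measurable M" unfolding j_def by measurable
      have j_int: "integrable M j"
        by (rule integrable_const_bound[where B=1]) (auto simp: j_def)
      let ?ij = "indicator (A -` S \<inter> C -` T \<inter> space M) :: 'a \<Rightarrow> real"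
      have ij_set: "A -` S \<inter> C -` T \<inter> space M = (A -` S \<inter> space M) \<inter> (C -` T \<inter> space M)" by auto
      have ij_int: "integrable M ?ij"
        by (rule integrable_const_bound[where B=1]) (auto simp: ij_set)
      have "(\<integral>\<omega>. i \<omega> * indicator S (A \<omega>) \<partial>M) = (\<integral>\<omega>. ?ij \<omega> \<partial>M)"
        by (intro Bochner_Integration.integral_cong) (auto simp: i_def indicator_def)
      also have "\<dots> = (\<integral>\<omega>. ?E ?ij \<omega> \<partial>M)"
        by (rule F.real_cond_exp_int(2)[OF ij_int, symmetric])
      \<comment> \<open>The conditional independence of events enters here.\<close>
      also have "\<dots> = (\<integral>\<omega>. ?E i \<omega> * ?E j \<omega> \<partial>M)"
        using ci S T by (intro integral_cong_AE)
          (auto simp: cond_indep_var_def i_def j_def mult.commute)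
      also have "\<dots> = (\<integral>\<omega>. ?E i \<omega> * j \<omega> \<partial>M)"
        using prod_int[OF j_int i_E] by (intro F.real_cond_exp_intg(2)) (auto simp: mult.commute)
      also have "\<dots> = (\<integral>\<omega>. ?E i \<omega> * indicator S (A \<omega>) \<partial>M)"
        by (intro Bochner_Integration.integral_cong) (auto simp: j_eq)
      finally show "(\<integral>\<omega>. i \<omega> * indicator S (A \<omega>) \<partial>M) = (\<integral>\<omega>. ?E i \<omega> * indicator S (A \<omega>) \<partial>M)" .
    qed (use i_int i01 i_E F.real_cond_exp_int(1)[OF i_int] in simp_all)
    also have "\<dots> = (\<integral>\<omega>. ?E i \<omega> * ?E (\<lambda>\<omega>. f (A \<omega>)) \<omega> \<partial>M)"
      using prod_int[OF f_int i_E] 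
      by (intro F.real_cond_exp_intg(2)[symmetric]) (auto simp: mult.commute)
    \<comment> \<open>Conditional expectation is self-adjoint: it moves from \<open>i\<close> to
      \<open>f (A \<omega>)\<close> by way of the product of both conditional expectations.\<close>
    also have "\<dots> = (\<integral>\<omega>. ?E (\<lambda>\<omega>. f (A \<omega>)) \<omega> * i \<omega> \<partial>M)"
    proof -
      have "integrable M (\<lambda>\<omega>. ?E (\<lambda>\<omega>. f (A \<omega>)) \<omega> * i \<omega>)"
        by (rule prod_int[OF F.real_cond_exp_int(1)[OF f_int]]) (use i01 in auto)
      then show ?thesis
        by (subst F.real_cond_exp_intg(2)[symmetric]) (auto simp: mult.commute)
    qed
    finally have "(\<integral>\<omega>. i \<omega> * f (A \<omega>) \<partial>M) = (\<integral>\<omega>. ?E (\<lambda>\<omega>. f (A \<omega>)) \<omega> * i \<omega> \<partial>M)" .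
    moreover have "(\<integral>\<omega>. f (A \<omega>) * indicator T (C \<omega>) \<partial>M) = (\<integral>\<omega>. i \<omega> * f (A \<omega>) \<partial>M)"
      by (intro Bochner_Integration.integral_cong) (auto simp: i_eq)
    moreover have "(\<integral>\<omega>. ?E (\<lambda>\<omega>. f (A \<omega>)) \<omega> * i \<omega> \<partial>M) =
        (\<integral>\<omega>. ?E (\<lambda>\<omega>. f (A \<omega>)) \<omega> * indicator T (C \<omega>) \<partial>M)"
      by (intro Bochner_Integration.integral_cong) (auto simp: i_eq)
    ultimately show "(\<integral>\<omega>. f (A \<omega>) * indicator T (C \<omega>) \<partial>M) =
        (\<integral>\<omega>. ?E (\<lambda>\<omega>. f (A \<omega>)) \<omega> * indicator T (C \<omega>) \<partial>M)"
      by simp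
  qed (use f_int f01 f_E F.real_cond_exp_int(1)[OF f_int] in simp_all)
qed

text \<open>Here \<phi> is a candidate for the conditional probability of \<open>A\<close> lying in
  \<open>S\<close> given \<open>B\<close>. Testing against the events \<open>R\<close> of
  \<open>B\<close> shows that conditioning \<open>indicator S\<close> times
  \<open>indicator T\<close> on \<open>B\<close> has the same effect as conditioning \<phi> times
  \<open>indicator T\<close>, and \<phi> can be pulled out.\<close>

lemma (in prob_space) cond_indep_varI:
  fixes \<phi> :: "'b set \<Rightarrow> 'c \<Rightarrow> real"
  assumes A[measurable]: "A \<in> M \<rightarrow>\<^sub>M MA" and B[measurable]: "B \<in> M \<rightarrow>\<^sub>M MB"
    and C[measurable]: "C \<in> M \<rightarrow>\<^sub>M MC"
    and \<phi>[measurable]: "\<And>S. S \<in> sets MA \<Longrightarrow> \<phi> S \<in> borel_measurable MB"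
    and \<phi>01: "\<And>S x. S \<in> sets MA \<Longrightarrow> 0 \<le> \<phi> S x \<and> \<phi> S x \<le> 1"
    and eq: "\<And>R S T. R \<in> sets MB \<Longrightarrow> S \<in> sets MA \<Longrightarrow> T \<in> sets MC \<Longrightarrow>
      (\<integral>\<omega>. indicator R (B \<omega>) * indicator S (A \<omega>) * indicator T (C \<omega>) \<partial>M) =
      (\<integral>\<omega>. indicator R (B \<omega>) * \<phi> S (B \<omega>) * indicator T (C \<omega>) \<partial>M)"
  shows "cond_indep_var M MA A MB B MC C"
  unfolding cond_indep_var_def
proof (intro ballI)
  fix S T assume S[measurable]: "S \<in> sets MA" and T[measurable]: "T \<in> sets MC"
  let ?F = "vimage_algebra (space M) B MB"
  let ?E = "real_cond_exp M ?F"
  interpret F: finite_measure_subalgebra M ?F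
    by (rule finite_measure_subalgebra_vimage[OF B])
  have Bsp: "B \<in> space M \<rightarrow> space MB" using B by (auto simp: measurable_def)
  have [measurable]: "\<phi> S \<in> borel_measurable MB" using S by simp
  have \<phi>B: "(\<lambda>\<omega>. \<phi> S (B \<omega>)) \<in> borel_measurable ?F"
    by (rule measurable_compose[OF measurable_vimage_algebra1[OF Bsp]]) simp
  let ?i = "\<lambda>T. indicator (C -` T \<inter> space M) :: 'a \<Rightarrow> real"
  let ?ij = "\<lambda>T. indicator (A -` S \<inter> C -` T \<inter> space M) :: 'a \<Rightarrow> real"
  have ij_set: "A -` S \<inter> C -` T \<inter> space M = (A -` S \<inter> space M) \<inter> (C -` T \<inter> space M)" for T by auto
  have key: "AE \<omega> in M. ?E (?ij T) \<omega> = \<phi> S (B \<omega>) * ?E (?i T) \<omega>" if T[measurable]: "T \<in> sets MC" for T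
  proof -
    have ij_int: "integrable M (?ij T)"
      by (rule integrable_const_bound[where B=1]) (auto simp: ij_set)
    have prod_int: "integrable M (\<lambda>\<omega>. \<phi> S (B \<omega>) * ?i T \<omega>)"
      by (rule integrable_const_bound[where B=1]) (use \<phi>01[OF S] in \<open>auto simp: indicator_def\<close>)
    have "AE \<omega> in M. ?E (?ij T) \<omega> = ?E (\<lambda>\<omega>. \<phi> S (B \<omega>) * ?i T \<omega>) \<omega>"
    proof (rule F.real_cond_exp_charact[OF _ ij_int])
      fix D assume D: "D \<in> sets ?F"
      then obtain R where R: "R \<in> sets MB" "D = B -` R \<inter> space M"
        using Bsp by (auto simp: sets_vimage_algebra2)
      have "(\<integral>\<omega>\<in>D. ?ij T \<omega> \<partial>M)
          = (\<integral>\<omega>. indicator R (B \<omega>) * indicator S (A \<omega>) * indicator T (C \<omega>) \<partial>M)"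
        unfolding set_lebesgue_integral_def R
        by (intro Bochner_Integration.integral_cong) (auto simp: indicator_def)
      also have "\<dots> = (\<integral>\<omega>. indicator R (B \<omega>) * \<phi> S (B \<omega>) * indicator T (C \<omega>) \<partial>M)"
        by (rule eq[OF R(1) S T])
      also have "\<dots> = (\<integral>\<omega>\<in>D. \<phi> S (B \<omega>) * ?i T \<omega> \<partial>M)"
        unfolding set_lebesgue_integral_def R
        by (intro Bochner_Integration.integral_cong) (auto simp: indicator_def)
      also have "\<dots> = (\<integral>\<omega>\<in>D. ?E (\<lambda>\<omega>. \<phi> S (B \<omega>) * ?i T \<omega>) \<omega> \<partial>M)"
        by (rule F.real_cond_exp_intA[OF prod_int D])
      finally show "(\<integral>\<omega>\<in>D. ?ij T \<omega> \<partial>M) = (\<integral>\<omega>\<in>D. ?E (\<lambda>\<omega>. \<phi> S (B \<omega>) * ?i T \<omega>) \<omega> \<partial>M)" .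
    next
      show "integrable M (?E (\<lambda>\<omega>. \<phi> S (B \<omega>) * ?i T \<omega>))"
        by (rule F.real_cond_exp_int(1)[OF prod_int])
    qed simp
    moreover have "AE \<omega> in M. ?E (\<lambda>\<omega>. \<phi> S (B \<omega>) * ?i T \<omega>) \<omega> = \<phi> S (B \<omega>) * ?E (?i T) \<omega>"
      by (rule F.real_cond_exp_mult[OF \<phi>B _ prod_int]) measurable
    ultimately show ?thesis by eventually_elim simp
  qed
  \<comment> \<open>Taking for \<open>T\<close> the whole space identifies \<phi> with the
    conditional probability of \<open>S\<close>, turning \<open>key\<close> into the product
    formula.\<close>
  have "?ij (space MC) = indicator (A -` S \<inter> space M)" "?i (space MC) = indicator (space M)"
    using measurable_space[OF C] by (auto simp: indicator_def fun_eq_iff)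
  with key[of "space MC"]
  have "AE \<omega> in M. ?E (indicator (A -` S \<inter> space M)) \<omega> = \<phi> S (B \<omega>) * ?E (indicator (space M)) \<omega>"
    by simp
  moreover have "AE \<omega> in M. ?E (indicator (space M)) \<omega> = indicator (space M) \<omega>"
  proof (rule F.real_cond_exp_F_meas)
    show "integrable M (indicator (space M) :: 'a \<Rightarrow> real)"
      by (rule integrable_real_indicator) (simp_all add: emeasure_space_1)
    show "(indicator (space M) :: 'a \<Rightarrow> real) \<in> borel_measurable ?F"
      using sets.top[of ?F] by (intro borel_measurable_indicator) simp
  qed
  ultimately show "AE \<omega> in M. ?E (?ij T) \<omega> = ?E (indicator (A -` S \<inter> space M)) \<omega> * ?E (?i T) \<omega>"
    using key[OF T] AE_space by eventually_elim simp
qed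

section \<open>Maximal leakage in terms of kernels\<close>

locale kernel_pair = prob_space M for M :: "'w measure" +
  fixes MX :: "'a measure" and X :: "'w \<Rightarrow> 'a" and MY :: "'b measure" and Y :: "'w \<Rightarrow> 'b"
    and A :: "nat set" and p :: "nat \<Rightarrow> 'a \<Rightarrow> real" and q :: "nat \<Rightarrow> 'b \<Rightarrow> real"
  assumes X[measurable]: "X \<in> M \<rightarrow>\<^sub>M MX" and Y[measurable]: "Y \<in> M \<rightarrow>\<^sub>M MY"
    and A: "finite A" "A \<noteq> {}"
    and p: "finite_kernel MX A p" and q: "finite_kernel MY A q"
begin

abbreviation target :: "(nat \<times> 'a \<times> 'b \<times> nat) measure"
  where "target \<equiv> count_space A \<Otimes>\<^sub>M MX \<Otimes>\<^sub>M MY \<Otimes>\<^sub>M count_space A"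

text \<open>Given a sample point, the letters \<open>u\<close> and \<open>v\<close> are drawn
  independently with probabilities \<open>p u (X \<omega>)\<close> and
  \<open>q v (Y \<omega>)\<close>. The base measure counts \<open>A \<times> A\<close>, since a
  finite kernel says nothing about indices outside \<open>A\<close>; this also reduces joint
  measurability to a fixed pair of letters.\<close>

definition law :: "(nat \<times> 'a \<times> 'b \<times> nat) measure"
  where "law = distr
    (density (count_space (A \<times> A) \<Otimes>\<^sub>M M) (\<lambda>(w, \<omega>). ennreal (p (fst w) (X \<omega>) * q (snd w) (Y \<omega>))))
    target (\<lambda>(w, \<omega>). (fst w, X \<omega>, Y \<omega>, snd w))"

lemma sets_law[measurable_cong, simp]: "sets law = sets target"
  by (simp add: law_def)

lemmas p_measurable = finite_kernel_measurable[OF p]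
lemmas q_measurable = finite_kernel_measurable[OF q]

lemma kernel_product_measurable:
  assumes "u \<in> A" "v \<in> A"
  shows "(\<lambda>\<omega>. p u (X \<omega>) * q v (Y \<omega>)) \<in> borel_measurable M"
  by (rule borel_measurable_times[OF measurable_compose[OF X p_measurable[OF assms(1)]]
        measurable_compose[OF Y q_measurable[OF assms(2)]]])

lemma measurable_count_space_pair:
  assumes "\<And>w. w \<in> A \<times> A \<Longrightarrow> (\<lambda>\<omega>. f w \<omega>) \<in> M \<rightarrow>\<^sub>M N"
  shows "(\<lambda>(w, \<omega>). f w \<omega>) \<in> count_space (A \<times> A) \<Otimes>\<^sub>M M \<rightarrow>\<^sub>M N"
  by (rule measurable_pair_measure_countable1) (use A assms in \<open>auto intro: countable_finite\<close>)

lemma nn_integral_law: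
  assumes F[measurable]: "F \<in> borel_measurable target"
  shows "(\<integral>\<^sup>+z. F z \<partial>law) = (\<integral>\<^sup>+\<omega>. (\<Sum>(u, v)\<in>A \<times> A.
    ennreal (p u (X \<omega>) * q v (Y \<omega>)) * F (u, X \<omega>, Y \<omega>, v)) \<partial>M)"
proof -
  interpret C: sigma_finite_measure "count_space (A \<times> A)"
    by (rule sigma_finite_measure_count_space_finite) (use A in simp)
  interpret pair_sigma_finite "count_space (A \<times> A)" M ..
  have dens[measurable]: "(\<lambda>(w, \<omega>). ennreal (p (fst w) (X \<omega>) * q (snd w) (Y \<omega>)))
      \<in> borel_measurable (count_space (A \<times> A) \<Otimes>\<^sub>M M)"
  proof (rule measurable_count_space_pair)
    fix w assume "w \<in> A \<times> A"
    then have "fst w \<in> A" "snd w \<in> A" by auto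
    from kernel_product_measurable[OF this]
    show "(\<lambda>\<omega>. ennreal (p (fst w) (X \<omega>) * q (snd w) (Y \<omega>))) \<in> borel_measurable M"
      by (rule measurable_compose[OF _ measurable_ennreal])
  qed
  have map[measurable]: "(\<lambda>(w, \<omega>). (fst w, X \<omega>, Y \<omega>, snd w))
      \<in> count_space (A \<times> A) \<Otimes>\<^sub>M M \<rightarrow>\<^sub>M target"
  proof (rule measurable_count_space_pair)
    fix w assume "w \<in> A \<times> A"
    then have "fst w \<in> A" "snd w \<in> A" by auto
    then show "(\<lambda>\<omega>. (fst w, X \<omega>, Y \<omega>, snd w)) \<in> M \<rightarrow>\<^sub>M target"
      by (auto intro!: measurable_Pair)
  qed
  let ?g = "\<lambda>w \<omega>. ennreal (p (fst w) (X \<omega>) * q (snd w) (Y \<omega>)) * F (fst w, X \<omega>, Y \<omega>, snd w)"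
  let ?W = "count_space (A \<times> A) \<Otimes>\<^sub>M M"
  let ?dens = "\<lambda>(w, \<omega>). ennreal (p (fst w) (X \<omega>) * q (snd w) (Y \<omega>))"
  let ?map = "\<lambda>(w, \<omega>). (fst w, X \<omega>, Y \<omega>, snd w)"
  have Fmap: "(\<lambda>z. F (?map z)) \<in> borel_measurable ?W"
    by (rule measurable_compose[OF map F])
  have g_eq: "(\<lambda>(w, \<omega>). ?g w \<omega>) = (\<lambda>z. ?dens z * F (?map z))"
    by (simp add: fun_eq_iff)
  have meas: "(\<lambda>(w, \<omega>). ?g w \<omega>) \<in> borel_measurable ?W"
    unfolding g_eq by (rule borel_measurable_times_ennreal[OF dens Fmap])
  have "F \<in> borel_measurable (distr (density ?W ?dens) target ?map)"
    using F by (simp only: measurable_distr_eq1)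
  moreover have "?map \<in> density ?W ?dens \<rightarrow>\<^sub>M target"
    by (subst measurable_cong_sets[OF sets_density refl]) (rule map)
  ultimately have "(\<integral>\<^sup>+z. F z \<partial>law) = (\<integral>\<^sup>+z. F (?map z) \<partial>density ?W ?dens)"
    unfolding law_def by (intro nn_integral_distr)
  also have "\<dots> = (\<integral>\<^sup>+z. (case z of (w, \<omega>) \<Rightarrow> ?g w \<omega>) \<partial>?W)"
    unfolding g_eq by (rule nn_integral_density[OF dens Fmap])
  also have "\<dots> = (\<integral>\<^sup>+\<omega>. (\<integral>\<^sup>+w. ?g w \<omega> \<partial>count_space (A \<times> A)) \<partial>M)"
    by (rule nn_integral_snd[OF meas, symmetric, unfolded prod.case])
  also have "\<dots> = (\<integral>\<^sup>+\<omega>. (\<Sum>w\<in>A \<times> A. ?g w \<omega>) \<partial>M)"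
    by (subst nn_integral_count_space_finite) (simp_all add: A)
  finally show ?thesis unfolding case_prod_unfold .
qed

text \<open>For nonnegative \<open>F\<close> both Bochner integrals are read off the corresponding
  nonnegative integrals, so the formula carries over without an integrability argument.\<close>

lemma integral_law:
  fixes F :: "nat \<times> 'a \<times> 'b \<times> nat \<Rightarrow> real"
  assumes F[measurable]: "F \<in> borel_measurable target"
    and nonneg: "\<And>u x y v. 0 \<le> F (u, x, y, v)"
  shows "(\<integral>z. F z \<partial>law) = (\<integral>\<omega>. (\<Sum>u\<in>A. \<Sum>v\<in>A.
    p u (X \<omega>) * q v (Y \<omega>) * F (u, X \<omega>, Y \<omega>, v)) \<partial>M)"
proof -
  let ?s = "\<lambda>\<omega>. \<Sum>u\<in>A. \<Sum>v\<in>A. p u (X \<omega>) * q v (Y \<omega>) * F (u, X \<omega>, Y \<omega>, v)"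
  have F0: "0 \<le> F z" for z by (cases z) (simp add: nonneg)
  have s0: "0 \<le> ?s \<omega>" for \<omega>
    by (intro sum_nonneg mult_nonneg_nonneg F0 finite_kernel_nonneg[OF p] finite_kernel_nonneg[OF q])
  have [measurable]: "(\<lambda>\<omega>. F (u, X \<omega>, Y \<omega>, v)) \<in> borel_measurable M" if "u \<in> A" "v \<in> A" for u v
  proof (rule measurable_compose[OF _ F])
    show "(\<lambda>\<omega>. (u, X \<omega>, Y \<omega>, v)) \<in> M \<rightarrow>\<^sub>M target"
      using that by (auto intro!: measurable_Pair)
  qed
  have [measurable]: "?s \<in> borel_measurable M"
    by (intro borel_measurable_sum borel_measurable_times[OF kernel_product_measurable]) auto
  have "(\<integral>z. F z \<partial>law) = enn2real (\<integral>\<^sup>+z. ennreal (F z) \<partial>law)"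
    by (rule integral_eq_nn_integral) (auto simp: F0)
  also have "(\<integral>\<^sup>+z. ennreal (F z) \<partial>law) = (\<integral>\<^sup>+\<omega>. ennreal (?s \<omega>) \<partial>M)"
  proof (subst nn_integral_law)
    have "(\<Sum>(u, v)\<in>A \<times> A. ennreal (p u (X \<omega>) * q v (Y \<omega>)) * ennreal (F (u, X \<omega>, Y \<omega>, v)))
        = ennreal (?s \<omega>)" for \<omega>
    proof -
      have "(\<Sum>(u, v)\<in>A \<times> A. ennreal (p u (X \<omega>) * q v (Y \<omega>)) * ennreal (F (u, X \<omega>, Y \<omega>, v)))
          = (\<Sum>(u, v)\<in>A \<times> A. ennreal (p u (X \<omega>) * q v (Y \<omega>) * F (u, X \<omega>, Y \<omega>, v)))"
        by (intro sum.cong refl)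
          (auto simp: ennreal_mult F0 finite_kernel_nonneg[OF p] finite_kernel_nonneg[OF q])
      also have "\<dots> = ennreal (\<Sum>(u, v)\<in>A \<times> A. p u (X \<omega>) * q v (Y \<omega>) * F (u, X \<omega>, Y \<omega>, v))"
        unfolding case_prod_unfold
        by (rule sum_ennreal)
          (auto intro!: mult_nonneg_nonneg F0 finite_kernel_nonneg[OF p] finite_kernel_nonneg[OF q])
      finally show ?thesis by (simp add: sum.cartesian_product)
    qed
    then show "(\<integral>\<^sup>+\<omega>. (\<Sum>(u, v)\<in>A \<times> A. ennreal (p u (X \<omega>) * q v (Y \<omega>)) *
        ennreal (F (u, X \<omega>, Y \<omega>, v))) \<partial>M) = (\<integral>\<^sup>+\<omega>. ennreal (?s \<omega>) \<partial>M)" by simp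
  qed simp
  also have "enn2real (\<integral>\<^sup>+\<omega>. ennreal (?s \<omega>) \<partial>M) = (\<integral>\<omega>. ?s \<omega> \<partial>M)"
    by (rule integral_eq_nn_integral[symmetric]) (auto simp: s0)
  finally show ?thesis .
qed

lemma kernel_sum_product:
  "(\<Sum>u\<in>A. \<Sum>v\<in>A. p u x * q v y * (f u * g v)) = (\<Sum>u\<in>A. p u x * f u) * (\<Sum>v\<in>A. q v y * g v)"
  by (simp add: sum_product algebra_simps)

lemma distr_law: "distr law (MX \<Otimes>\<^sub>M MY) (\<lambda>(u, x, y, v). (x, y)) =
  distr M (MX \<Otimes>\<^sub>M MY) (\<lambda>\<omega>. (X \<omega>, Y \<omega>))"
proof (rule measure_eqI)
  fix S assume "S \<in> sets (distr law (MX \<Otimes>\<^sub>M MY) (\<lambda>(u, x, y, v). (x, y)))"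
  then have S[measurable]: "S \<in> sets (MX \<Otimes>\<^sub>M MY)" by simp
  \<comment> \<open>The weights of all pairs of letters sum to one at each point, so forgetting the
    letters returns the law of \<open>(X, Y)\<close>.\<close>
  have one: "(\<Sum>(u, v)\<in>A \<times> A. ennreal (p u x * q v y)) = 1" for x y
  proof -
    have "(\<Sum>(u, v)\<in>A \<times> A. ennreal (p u x * q v y)) = ennreal (\<Sum>(u, v)\<in>A \<times> A. p u x * q v y)"
      unfolding case_prod_unfold by (rule sum_ennreal)
        (auto intro!: mult_nonneg_nonneg finite_kernel_nonneg[OF p] finite_kernel_nonneg[OF q])
    also have "(\<Sum>(u, v)\<in>A \<times> A. p u x * q v y) = 1"
      by (simp add: sum.cartesian_product[symmetric] sum_product[symmetric]
          finite_kernel_sum[OF p] finite_kernel_sum[OF q])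
    finally show ?thesis by simp
  qed
  have "emeasure (distr law (MX \<Otimes>\<^sub>M MY) (\<lambda>(u, x, y, v). (x, y))) S
      = (\<integral>\<^sup>+z. indicator S z \<partial>distr law (MX \<Otimes>\<^sub>M MY) (\<lambda>(u, x, y, v). (x, y)))"
    by simp
  also have "\<dots> = (\<integral>\<^sup>+z. indicator S (case z of (u, x, y, v) \<Rightarrow> (x, y)) \<partial>law)"
    by (rule nn_integral_distr) measurable
  also have "\<dots> = (\<integral>\<^sup>+\<omega>. indicator S (X \<omega>, Y \<omega>) \<partial>M)"
    by (subst nn_integral_law)
      (simp_all add: case_prod_unfold sum_distrib_right[symmetric] one[unfolded case_prod_unfold])
  also have "\<dots> = (\<integral>\<^sup>+z. indicator S z \<partial>distr M (MX \<Otimes>\<^sub>M MY) (\<lambda>\<omega>. (X \<omega>, Y \<omega>)))"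
    by (rule nn_integral_distr[symmetric]) measurable
  also have "\<dots> = emeasure (distr M (MX \<Otimes>\<^sub>M MY) (\<lambda>\<omega>. (X \<omega>, Y \<omega>))) S"
    by simp
  finally show "emeasure (distr law (MX \<Otimes>\<^sub>M MY) (\<lambda>(u, x, y, v). (x, y))) S =
    emeasure (distr M (MX \<Otimes>\<^sub>M MY) (\<lambda>\<omega>. (X \<omega>, Y \<omega>))) S" .
qed simp

text \<open>A pushforward keeps the total mass, and the pushforward to the two middle coordinates is
  already known to be a probability law.\<close>

lemma prob_space_law: "prob_space law"
proof (rule prob_space_distrD)
  show "(\<lambda>(u, x, y, v). (x, y)) \<in> law \<rightarrow>\<^sub>M MX \<Otimes>\<^sub>M MY" by measurable
  show "prob_space (distr law (MX \<Otimes>\<^sub>M MY) (\<lambda>(u, x, y, v). (x, y)))"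
    unfolding distr_law by (rule prob_space_distr) measurable
qed

text \<open>The sum is the probability that a letter drawn from the kernel at \<open>x\<close> lies
  in \<open>S\<close>; it is the candidate \<phi> for \<open>cond_indep_varI\<close>.\<close>

lemma kernel_weight_bounds:
  assumes "finite_kernel N A r"
  shows "0 \<le> (\<Sum>u\<in>A. r u x * indicator S u)" "(\<Sum>u\<in>A. r u x * indicator S u) \<le> (1::real)"
proof -
  show "0 \<le> (\<Sum>u\<in>A. r u x * indicator S u)"
    by (intro sum_nonneg mult_nonneg_nonneg finite_kernel_nonneg[OF assms]) auto
  have "(\<Sum>u\<in>A. r u x * indicator S u) \<le> (\<Sum>u\<in>A. r u x)"
    by (intro sum_mono mult_left_le) (auto simp: finite_kernel_nonneg[OF assms] indicator_def)
  then show "(\<Sum>u\<in>A. r u x * indicator S u) \<le> (1::real)"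
    using finite_kernel_sum[OF assms] by simp
qed

lemma kernel_weight_measurable:
  assumes "finite_kernel N A r"
  shows "(\<lambda>x. \<Sum>u\<in>A. r u x * indicator S u :: real) \<in> borel_measurable N"
  using finite_kernel_measurable[OF assms] by (intro borel_measurable_sum borel_measurable_times) auto

lemmas p_weight_measurable[measurable] = kernel_weight_measurable[OF p]
lemmas q_weight_measurable[measurable] = kernel_weight_measurable[OF q]

lemma markov_chain4_law: "markov_chain4 law (count_space A) (\<lambda>(u, x, y, v). u) MX (\<lambda>(u, x, y, v). x)
  MY (\<lambda>(u, x, y, v). y) (count_space A) (\<lambda>(u, x, y, v). v)"
  unfolding markov_chain4_def
proof
  interpret L: prob_space law by (rule prob_space_law)
  show "cond_indep_var law (count_space A) (\<lambda>(u, x, y, v). u) MX (\<lambda>(u, x, y, v). x)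
     (MY \<Otimes>\<^sub>M count_space A) (\<lambda>\<omega>. (case \<omega> of (u, x, y, v) \<Rightarrow> y, case \<omega> of (u, x, y, v) \<Rightarrow> v))"
  proof (rule L.cond_indep_varI[where \<phi> = "\<lambda>S x. \<Sum>u\<in>A. p u x * indicator S u"])
    fix R S T assume [measurable]: "R \<in> sets MX" "S \<in> sets (count_space A)"
      and T[measurable]: "T \<in> sets (MY \<Otimes>\<^sub>M count_space A)"
    let ?F = "\<lambda>(u, x, y, v). indicator R x * indicator S u * indicator T (y, v) :: real"
    let ?G = "\<lambda>(u, x, y, v). indicator R x * (\<Sum>u\<in>A. p u x * indicator S u) * indicator T (y, v) :: real"
    have "(\<integral>z. ?F z \<partial>law) = (\<integral>z. ?G z \<partial>law)"
    proof (subst (1 2) integral_law)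
      \<comment> \<open>Both double sums factor over \<open>u\<close> and \<open>v\<close>. In
        \<open>?F\<close> the factor over \<open>u\<close> produces the kernel weight of
        \<open>S\<close>; in \<open>?G\<close> that weight is constant in \<open>u\<close> and is
        multiplied by a sum of \<open>p\<close> equal to one.\<close>
      have "(\<Sum>u\<in>A. \<Sum>v\<in>A. p u x * q v y * ?F (u, x, y, v)) =
        (\<Sum>u\<in>A. \<Sum>v\<in>A. p u x * q v y * ?G (u, x, y, v))" for x y
        using kernel_sum_product[of x y "\<lambda>u. indicator R x * indicator S u" "\<lambda>v. indicator T (y, v)"]
          kernel_sum_product[of x y "\<lambda>_. indicator R x * (\<Sum>u\<in>A. p u x * indicator S u)" "\<lambda>v. indicator T (y, v)"]
        by (simp add: sum_distrib_left[symmetric] sum_distrib_right[symmetric] mult.left_commute[of _ "indicator R x"]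
            finite_kernel_sum[OF p])
      then show "(\<integral>\<omega>. (\<Sum>u\<in>A. \<Sum>v\<in>A. p u (X \<omega>) * q v (Y \<omega>) * ?F (u, X \<omega>, Y \<omega>, v)) \<partial>M) =
        (\<integral>\<omega>. (\<Sum>u\<in>A. \<Sum>v\<in>A. p u (X \<omega>) * q v (Y \<omega>) * ?G (u, X \<omega>, Y \<omega>, v)) \<partial>M)" by presburger
    qed (measurable, auto intro!: mult_nonneg_nonneg kernel_weight_bounds[OF p])
    then show "(\<integral>\<omega>. indicator R (case \<omega> of (u, x, y, v) \<Rightarrow> x) * indicator S (case \<omega> of (u, x, y, v) \<Rightarrow> u) *
        indicator T (case \<omega> of (u, x, y, v) \<Rightarrow> y, case \<omega> of (u, x, y, v) \<Rightarrow> v) \<partial>law) =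
      (\<integral>\<omega>. indicator R (case \<omega> of (u, x, y, v) \<Rightarrow> x) *
        (\<Sum>u\<in>A. p u (case \<omega> of (u, x, y, v) \<Rightarrow> x) * indicator S u) *
        indicator T (case \<omega> of (u, x, y, v) \<Rightarrow> y, case \<omega> of (u, x, y, v) \<Rightarrow> v) \<partial>law)"
      by (simp add: case_prod_unfold)
  qed (measurable, simp_all add: kernel_weight_bounds[OF p])
  \<comment> \<open>The criterion needs an explicit conditional probability of its first variable.
    Given the third coordinate this is available for \<open>v\<close>, whose weight is
    \<open>q v y\<close>, so the chain is proved in reverse and then commuted.\<close>
  have "cond_indep_var law (count_space A) (\<lambda>(u, x, y, v). v) MY (\<lambda>(u, x, y, v). y)
     (count_space A \<Otimes>\<^sub>M MX) (\<lambda>\<omega>. (case \<omega> of (u, x, y, v) \<Rightarrow> u, case \<omega> of (u, x, y, v) \<Rightarrow> x))"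
  proof (rule L.cond_indep_varI[where \<phi> = "\<lambda>S y. \<Sum>v\<in>A. q v y * indicator S v"])
    fix R S T assume [measurable]: "R \<in> sets MY" "S \<in> sets (count_space A)"
      and T[measurable]: "T \<in> sets (count_space A \<Otimes>\<^sub>M MX)"
    let ?F = "\<lambda>(u, x, y, v). indicator R y * indicator S v * indicator T (u, x) :: real"
    let ?G = "\<lambda>(u, x, y, v). indicator R y * (\<Sum>v\<in>A. q v y * indicator S v) * indicator T (u, x) :: real"
    have "(\<integral>z. ?F z \<partial>law) = (\<integral>z. ?G z \<partial>law)"
    proof (subst (1 2) integral_law)
      have "(\<Sum>u\<in>A. \<Sum>v\<in>A. p u x * q v y * ?F (u, x, y, v)) =
        (\<Sum>u\<in>A. \<Sum>v\<in>A. p u x * q v y * ?G (u, x, y, v))" for x y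
        using kernel_sum_product[of x y "\<lambda>u. indicator T (u, x)" "\<lambda>v. indicator R y * indicator S v"]
          kernel_sum_product[of x y "\<lambda>u. indicator T (u, x)" "\<lambda>_. indicator R y * (\<Sum>v\<in>A. q v y * indicator S v)"]
        by (simp add: sum_distrib_left[symmetric] sum_distrib_right[symmetric] mult.left_commute[of _ "indicator R y"]
            finite_kernel_sum[OF q] mult.commute[of _ "indicator T (_, x)"]) argo
      then show "(\<integral>\<omega>. (\<Sum>u\<in>A. \<Sum>v\<in>A. p u (X \<omega>) * q v (Y \<omega>) * ?F (u, X \<omega>, Y \<omega>, v)) \<partial>M) =
        (\<integral>\<omega>. (\<Sum>u\<in>A. \<Sum>v\<in>A. p u (X \<omega>) * q v (Y \<omega>) * ?G (u, X \<omega>, Y \<omega>, v)) \<partial>M)" by presburger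
    qed (measurable, auto intro!: mult_nonneg_nonneg kernel_weight_bounds[OF q])
    then show "(\<integral>\<omega>. indicator R (case \<omega> of (u, x, y, v) \<Rightarrow> y) * indicator S (case \<omega> of (u, x, y, v) \<Rightarrow> v) *
        indicator T (case \<omega> of (u, x, y, v) \<Rightarrow> u, case \<omega> of (u, x, y, v) \<Rightarrow> x) \<partial>law) =
      (\<integral>\<omega>. indicator R (case \<omega> of (u, x, y, v) \<Rightarrow> y) *
        (\<Sum>v\<in>A. q v (case \<omega> of (u, x, y, v) \<Rightarrow> y) * indicator S v) *
        indicator T (case \<omega> of (u, x, y, v) \<Rightarrow> u, case \<omega> of (u, x, y, v) \<Rightarrow> x) \<partial>law)"
      by (simp add: case_prod_unfold)
  qed (measurable, simp_all add: kernel_weight_bounds[OF q])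
  then show "cond_indep_var law (count_space A \<Otimes>\<^sub>M MX)
     (\<lambda>\<omega>. (case \<omega> of (u, x, y, v) \<Rightarrow> u, case \<omega> of (u, x, y, v) \<Rightarrow> x)) MY
     (\<lambda>(u, x, y, v). y) (count_space A) (\<lambda>(u, x, y, v). v)"
    by (rule cond_indep_var_commute)
qed

lemma law_in_leakage_laws:
  "law \<in> leakage_laws MX MY (distr M (MX \<Otimes>\<^sub>M MY) (\<lambda>\<omega>. (X \<omega>, Y \<omega>))) A"
  by (simp add: leakage_laws_def prob_space_law distr_law markov_chain4_law)

text \<open>On a finite alphabet the product sigma-algebra is the full power set, so the diagonal is
  measurable.\<close>

lemma measurable_guess_correct:
  "(\<lambda>(u, x, y, v). if u = v then 1 else 0 :: real) \<in> borel_measurable target"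
proof -
  have "(\<lambda>(u, x, y, v). (u, v)) \<in> target \<rightarrow>\<^sub>M count_space A \<Otimes>\<^sub>M count_space A" by measurable
  then have "(\<lambda>(u, x, y, v). (u, v)) \<in> target \<rightarrow>\<^sub>M count_space (A \<times> A)"
    using A by (simp add: pair_measure_countable countable_finite)
  moreover have "(\<lambda>(u, v). if u = v then 1 else 0 :: real) \<in> borel_measurable (count_space (A \<times> A))"
    by simp
  ultimately have "(\<lambda>z. case (case z of (u, x, y, v) \<Rightarrow> (u, v)) of (u, v) \<Rightarrow> (if u = v then 1 else 0 :: real))
      \<in> borel_measurable target"
    by (rule measurable_compose)
  then show ?thesis by (simp add: case_prod_unfold)
qed

lemma measure_law_guess:
  "measure law {(u, x, y, v) \<in> space law. u = v} = (\<integral>\<omega>. (\<Sum>a\<in>A. p a (X \<omega>) * q a (Y \<omega>)) \<partial>M)"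
proof -
  have "measure law {(u, x, y, v) \<in> space law. u = v} =
      (\<integral>z. indicator {(u, x, y, v) \<in> space law. u = v} z \<partial>law)"
    by simp (intro arg_cong[where f="measure law"], auto)
  also have "\<dots> = (\<integral>z. (case z of (u, x, y, v) \<Rightarrow> if u = v then 1 else 0) \<partial>law)"
    by (rule Bochner_Integration.integral_cong) (auto simp: indicator_def split: if_splits)
  also have "\<dots> = (\<integral>\<omega>. (\<Sum>u\<in>A. \<Sum>v\<in>A. p u (X \<omega>) * q v (Y \<omega>) * (if u = v then 1 else 0)) \<partial>M)"
    by (subst integral_law[OF measurable_guess_correct]) simp_all
  also have "\<dots> = (\<integral>\<omega>. (\<Sum>a\<in>A. p a (X \<omega>) * q a (Y \<omega>)) \<partial>M)"
    using A by (simp add: if_distrib[of "(*) _"] cong: if_cong)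
  finally show ?thesis .
qed

lemma measure_law_prior:
  assumes "a \<in> A"
  shows "measure law {(u, x, y, v) \<in> space law. u = a} = (\<integral>\<omega>. p a (X \<omega>) \<partial>M)"
proof -
  have "measure law {(u, x, y, v) \<in> space law. u = a} =
      (\<integral>z. indicator {(u, x, y, v) \<in> space law. u = a} z \<partial>law)"
    by simp (intro arg_cong[where f="measure law"], auto)
  also have "\<dots> = (\<integral>z. (case z of (u, x, y, v) \<Rightarrow> if u = a then 1 else 0) \<partial>law)"
    by (rule Bochner_Integration.integral_cong) (auto simp: indicator_def split: if_splits)
  also have "\<dots> = (\<integral>\<omega>. (\<Sum>u\<in>A. \<Sum>v\<in>A. p u (X \<omega>) * q v (Y \<omega>) * (if u = a then 1 else 0)) \<partial>M)"
    by (subst integral_law) simp_all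
  also have "\<dots> = (\<integral>\<omega>. p a (X \<omega>) \<partial>M)"
  proof -
    have "(\<Sum>u\<in>A. \<Sum>v\<in>A. p u x * q v y * (if u = a then 1 else 0)) = p a x" for x y
      using kernel_sum_product[of x y "\<lambda>u. if u = a then 1 else 0" "\<lambda>_. 1"] A assms
      by (simp add: finite_kernel_sum[OF q] if_distrib[of "(*) _"] cong: if_cong)
    then show ?thesis by simp
  qed
  finally show ?thesis .
qed


lemma integrable_kernel_product:
  assumes "a \<in> A"
  shows "integrable M (\<lambda>\<omega>. p a (X \<omega>) * q a (Y \<omega>))"
proof (rule integrable_const_bound[where B=1])
  show "AE \<omega> in M. norm (p a (X \<omega>) * q a (Y \<omega>)) \<le> 1"
    using finite_kernel_nonneg[OF p assms] finite_kernel_nonneg[OF q assms]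
      finite_kernel_le_1[OF p A(1) assms] finite_kernel_le_1[OF q A(1) assms]
    by (intro always_eventually) (simp add: abs_mult mult_le_one)
  show "(\<lambda>\<omega>. p a (X \<omega>) * q a (Y \<omega>)) \<in> borel_measurable M"
    by (rule kernel_product_measurable[OF assms assms])
qed

lemma integral_kernel_products:
  "(\<integral>\<omega>. (\<Sum>a\<in>A. p a (X \<omega>) * q a (Y \<omega>)) \<partial>M) = (\<Sum>a\<in>A. \<integral>\<omega>. p a (X \<omega>) * q a (Y \<omega>) \<partial>M)"
  by (rule Bochner_Integration.integral_sum) (rule integrable_kernel_product)

lemma prior_le_Max:
  "a \<in> A \<Longrightarrow> (\<integral>\<omega>. p a (X \<omega>) \<partial>M) \<le> Max ((\<lambda>a. \<integral>\<omega>. p a (X \<omega>) \<partial>M) ` A)"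
  using A by simp

text \<open>The prior probabilities sum to one, so not all are nonpositive. This permits clearing
  the denominator of the gain.\<close>

lemma Max_prior_pos: "0 < Max ((\<lambda>a. \<integral>\<omega>. p a (X \<omega>) \<partial>M) ` A)"
proof (rule ccontr)
  assume "\<not> 0 < Max ((\<lambda>a. \<integral>\<omega>. p a (X \<omega>) \<partial>M) ` A)"
  then have "(\<integral>\<omega>. p a (X \<omega>) \<partial>M) \<le> 0" if "a \<in> A" for a
    using prior_le_Max[OF that] by linarith
  then have "(\<Sum>a\<in>A. \<integral>\<omega>. p a (X \<omega>) \<partial>M) \<le> 0" by (rule sum_nonpos)
  then show False using finite_kernel_expectation(2)[OF p A(1) X] by simp
qed

end

section \<open>Leakage as a supremum over kernels\<close>

definition kernel_gain :: "'w measure \<Rightarrow> ('w \<Rightarrow> 'a) \<Rightarrow> ('w \<Rightarrow> 'b) \<Rightarrow> nat set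
    \<Rightarrow> (nat \<Rightarrow> 'a \<Rightarrow> real) \<Rightarrow> (nat \<Rightarrow> 'b \<Rightarrow> real) \<Rightarrow> ereal"
  where "kernel_gain M X Y A p q = elog (ennreal
    ((\<integral>\<omega>. (\<Sum>a\<in>A. p a (X \<omega>) * q a (Y \<omega>)) \<partial>M) / Max ((\<lambda>a. \<integral>\<omega>. p a (X \<omega>) \<partial>M) ` A)))"

text \<open>The kernels are the conditional probabilities of the letters under \<open>Q\<close>,
  given the second and the third coordinate respectively.\<close>

lemma leakage_law_kernels:
  assumes M: "prob_space M" and X[measurable]: "X \<in> M \<rightarrow>\<^sub>M MX" and Y[measurable]: "Y \<in> M \<rightarrow>\<^sub>M MY"
    and A: "finite A" "A \<noteq> {}"
    and Q: "Q \<in> leakage_laws MX MY (distr M (MX \<Otimes>\<^sub>M MY) (\<lambda>\<omega>. (X \<omega>, Y \<omega>))) A"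
  obtains p q where "kernel_pair M MX X MY Y A p q" "guessing_gain A Q = kernel_gain M X Y A p q"
proof -
  define U :: "nat \<times> 'b \<times> 'c \<times> nat \<Rightarrow> nat" where "U = (\<lambda>(u, x, y, v). u)"
  define X' :: "nat \<times> 'b \<times> 'c \<times> nat \<Rightarrow> 'b" where "X' = (\<lambda>(u, x, y, v). x)"
  define Y' :: "nat \<times> 'b \<times> 'c \<times> nat \<Rightarrow> 'c" where "Y' = (\<lambda>(u, x, y, v). y)"
  define V :: "nat \<times> 'b \<times> 'c \<times> nat \<Rightarrow> nat" where "V = (\<lambda>(u, x, y, v). v)"
  have sets_Q[measurable_cong]: "sets Q = sets (count_space A \<Otimes>\<^sub>M MX \<Otimes>\<^sub>M MY \<Otimes>\<^sub>M count_space A)"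
    and distr_Q: "distr Q (MX \<Otimes>\<^sub>M MY) (\<lambda>(u, x, y, v). (x, y)) =
      distr M (MX \<Otimes>\<^sub>M MY) (\<lambda>\<omega>. (X \<omega>, Y \<omega>))"
    and prob_Q: "prob_space Q"
    and mc: "markov_chain4 Q (count_space A) U MX X' MY Y' (count_space A) V"
    using Q by (auto simp: leakage_laws_def U_def V_def X'_def Y'_def)
  interpret Q: prob_space Q by (rule prob_Q)
  have U[measurable]: "U \<in> Q \<rightarrow>\<^sub>M count_space A" unfolding U_def by measurable
  have V[measurable]: "V \<in> Q \<rightarrow>\<^sub>M count_space A" unfolding V_def by measurable
  have X'[measurable]: "X' \<in> Q \<rightarrow>\<^sub>M MX" unfolding X'_def by measurable
  have Y'[measurable]: "Y' \<in> Q \<rightarrow>\<^sub>M MY" unfolding Y'_def by measurable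
  have UA: "U z \<in> A" and VA: "V z \<in> A" if "z \<in> space Q" for z
    using measurable_space[OF U that] measurable_space[OF V that] by auto
  have ind_meas: "(\<lambda>z. indicator {a} (W z) :: real) \<in> borel_measurable Q"
    if "W \<in> Q \<rightarrow>\<^sub>M count_space A" for a W
    by (rule measurable_compose[OF that]) simp
  have ind_sum: "(\<Sum>a\<in>A. indicator {a} w) = (1::real)" if "w \<in> A" for w
    using A that by (simp add: indicator_def)
  obtain p where p: "finite_kernel MX A p" and pE: "\<And>a. a \<in> A \<Longrightarrow>
      AE z in Q. real_cond_exp Q (vimage_algebra (space Q) X' MX) (\<lambda>z. indicator {a} (U z)) z = p a (X' z)"
    by (rule Q.exists_conditional_kernel[OF X' A(1), of "\<lambda>a z. indicator {a} (U z)"])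
      (use ind_meas[OF U] ind_sum UA in auto)
  obtain q where q: "finite_kernel MY A q" and qE: "\<And>a. a \<in> A \<Longrightarrow>
      AE z in Q. real_cond_exp Q (vimage_algebra (space Q) Y' MY) (\<lambda>z. indicator {a} (V z)) z = q a (Y' z)"
    by (rule Q.exists_conditional_kernel[OF Y' A(1), of "\<lambda>a z. indicator {a} (V z)"])
      (use ind_meas[OF V] ind_sum VA in auto)
  interpret MK: kernel_pair M MX X MY Y A p q
    using M X Y A p q by (simp add: kernel_pair_def kernel_pair_axioms_def)
  interpret QK: kernel_pair Q MX X' MY Y' A p q
    using prob_Q X' Y' A p q by (simp add: kernel_pair_def kernel_pair_axioms_def)
  \<comment> \<open>The link between \<open>Q\<close> and \<open>M\<close>: both give the pair of
    middle coordinates, respectively \<open>(X, Y)\<close>, the same law.\<close>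
  have transfer: "(\<integral>z. G (X' z, Y' z) \<partial>Q) = (\<integral>\<omega>. G (X \<omega>, Y \<omega>) \<partial>M)"
    if G: "G \<in> borel_measurable (MX \<Otimes>\<^sub>M MY)" for G :: "'b \<times> 'c \<Rightarrow> real"
  proof -
    have "(\<lambda>(u, x, y, v). (x, y)) = (\<lambda>z. (X' z, Y' z))"
      by (simp add: X'_def Y'_def fun_eq_iff)
    with distr_Q have "distr Q (MX \<Otimes>\<^sub>M MY) (\<lambda>z. (X' z, Y' z)) =
      distr M (MX \<Otimes>\<^sub>M MY) (\<lambda>\<omega>. (X \<omega>, Y \<omega>))" by simp
    then have "(\<integral>z. G z \<partial>distr Q (MX \<Otimes>\<^sub>M MY) (\<lambda>z. (X' z, Y' z))) =
      (\<integral>z. G z \<partial>distr M (MX \<Otimes>\<^sub>M MY) (\<lambda>\<omega>. (X \<omega>, Y \<omega>)))" by simp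
    moreover have "(\<integral>z. G z \<partial>distr Q (MX \<Otimes>\<^sub>M MY) (\<lambda>z. (X' z, Y' z))) = (\<integral>z. G (X' z, Y' z) \<partial>Q)"
      by (rule integral_distr[OF _ G]) measurable
    moreover have "(\<integral>z. G z \<partial>distr M (MX \<Otimes>\<^sub>M MY) (\<lambda>\<omega>. (X \<omega>, Y \<omega>))) = (\<integral>\<omega>. G (X \<omega>, Y \<omega>) \<partial>M)"
      by (rule integral_distr[OF _ G]) measurable
    ultimately show ?thesis by simp
  qed
  have ci1: "cond_indep_var Q (count_space A) U MX X' (MY \<Otimes>\<^sub>M count_space A) (\<lambda>z. (Y' z, V z))"
    and ci2: "cond_indep_var Q (count_space A) V MY Y' (count_space A \<Otimes>\<^sub>M MX) (\<lambda>z. (U z, X' z))"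
    using mc by (auto simp: markov_chain4_def intro: cond_indep_var_commute)
  have joint: "(\<integral>z. indicator {a} (V z) * indicator {a} (U z) \<partial>Q) = (\<integral>\<omega>. p a (X \<omega>) * q a (Y \<omega>) \<partial>M)"
    if a: "a \<in> A" for a
  proof -
    note [measurable] = finite_kernel_measurable[OF p a] finite_kernel_measurable[OF q a]
    have fst_meas: "(\<lambda>(u, x). indicator {a} u :: real) \<in> borel_measurable (count_space A \<Otimes>\<^sub>M MX)"
      unfolding case_prod_unfold by (rule measurable_compose[OF measurable_fst]) simp
    \<comment> \<open>First \<open>V\<close> is averaged out given \<open>Y'\<close>, where it is
      independent of \<open>(U, X')\<close>.\<close>
    have "(\<integral>z. indicator {a} (V z) * indicator {a} (U z) \<partial>Q) =
      (\<integral>z. real_cond_exp Q (vimage_algebra (space Q) Y' MY) (\<lambda>z. indicator {a} (V z)) z *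
        indicator {a} (U z) \<partial>Q)"
      using Q.cond_indep_var_integral[OF ci2 V Y' _ _ _ fst_meas, of "indicator {a}"]
      by simp
    also have "\<dots> = (\<integral>z. indicator {a} (U z) * q a (Y' z) \<partial>Q)"
    proof (rule integral_cong_AE)
      show "AE z in Q. real_cond_exp Q (vimage_algebra (space Q) Y' MY) (\<lambda>z. indicator {a} (V z)) z *
        indicator {a} (U z) = indicator {a} (U z) * q a (Y' z)"
        using qE[OF a] by eventually_elim simp
    qed (use ind_meas[OF U] in measurable)
    \<comment> \<open>What remains besides \<open>U\<close> is a function of \<open>Y'\<close>, so
      the other half of the chain averages out \<open>U\<close> given \<open>X'\<close>.\<close>
    also have "\<dots> = (\<integral>z. real_cond_exp Q (vimage_algebra (space Q) X' MX) (\<lambda>z. indicator {a} (U z)) z *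
        q a (Y' z) \<partial>Q)"
      using Q.cond_indep_var_integral[OF ci1 U X' _ _ _, of "indicator {a}" "\<lambda>(y, v). q a y"]
      by simp
    also have "\<dots> = (\<integral>z. p a (X' z) * q a (Y' z) \<partial>Q)"
    proof (rule integral_cong_AE)
      show "AE z in Q. real_cond_exp Q (vimage_algebra (space Q) X' MX) (\<lambda>z. indicator {a} (U z)) z *
        q a (Y' z) = p a (X' z) * q a (Y' z)"
        using pE[OF a] by eventually_elim simp
    qed measurable
    also have "\<dots> = (\<integral>\<omega>. p a (X \<omega>) * q a (Y \<omega>) \<partial>M)"
      using transfer[of "\<lambda>(x, y). p a x * q a y"] by simp
    finally show ?thesis .
  qed
  have "measure Q {(u, x, y, v) \<in> space Q. u = v} =
      (\<integral>z. indicator {(u, x, y, v) \<in> space Q. u = v} z \<partial>Q)"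
    by simp (intro arg_cong[where f="measure Q"], auto)
  also have "\<dots> = (\<integral>z. (\<Sum>a\<in>A. indicator {a} (V z) * indicator {a} (U z)) \<partial>Q)"
  proof (rule Bochner_Integration.integral_cong)
    fix z assume z: "z \<in> space Q"
    have "(\<Sum>a\<in>A. indicator {a} (V z) * indicator {a} (U z)) =
        (\<Sum>a\<in>A. if a = U z then indicator {a} (V z) else 0 :: real)"
      by (intro sum.cong) (auto simp: indicator_def)
    also have "\<dots> = indicator {U z} (V z)" using A UA[OF z] by simp
    also have "\<dots> = indicator {(u, x, y, v) \<in> space Q. u = v} z"
      using z by (auto simp: indicator_def U_def V_def)
    finally show "indicator {(u, x, y, v) \<in> space Q. u = v} z =
      (\<Sum>a\<in>A. indicator {a} (V z) * indicator {a} (U z) :: real)" by simp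
  qed simp
  also have "\<dots> = (\<Sum>a\<in>A. \<integral>z. indicator {a} (V z) * indicator {a} (U z) \<partial>Q)"
  proof (rule Bochner_Integration.integral_sum)
    fix a
    show "integrable Q (\<lambda>z. indicator {a} (V z) * indicator {a} (U z) :: real)"
    proof (rule Q.integrable_const_bound[where B=1])
      show "(\<lambda>z. indicator {a} (V z) * indicator {a} (U z) :: real) \<in> borel_measurable Q"
        by (intro borel_measurable_times ind_meas U V)
    qed (auto simp: indicator_def)
  qed
  also have "\<dots> = (\<integral>\<omega>. (\<Sum>a\<in>A. p a (X \<omega>) * q a (Y \<omega>)) \<partial>M)"
    unfolding MK.integral_kernel_products by (rule sum.cong[OF refl joint])
  finally have guess: "measure Q {(u, x, y, v) \<in> space Q. u = v} =
    (\<integral>\<omega>. (\<Sum>a\<in>A. p a (X \<omega>) * q a (Y \<omega>)) \<partial>M)" .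
  have prior: "measure Q {(u, x, y, v) \<in> space Q. u = a} = (\<integral>\<omega>. p a (X \<omega>) \<partial>M)" if a: "a \<in> A" for a
  proof -
    interpret F: finite_measure_subalgebra Q "vimage_algebra (space Q) X' MX"
      by (rule Q.finite_measure_subalgebra_vimage[OF X'])
    note [measurable] = finite_kernel_measurable[OF p a]
    have int: "integrable Q (\<lambda>z. indicator {a} (U z) :: real)"
      by (rule Q.integrable_const_bound[where B=1]) (use ind_meas[OF U] in auto)
    have "measure Q {(u, x, y, v) \<in> space Q. u = a} =
        (\<integral>z. indicator {(u, x, y, v) \<in> space Q. u = a} z \<partial>Q)"
      by simp (intro arg_cong[where f="measure Q"], auto)
    also have "\<dots> = (\<integral>z. indicator {a} (U z) \<partial>Q)"
      by (rule Bochner_Integration.integral_cong) (auto simp: indicator_def U_def)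
    also have "\<dots> = (\<integral>z. real_cond_exp Q (vimage_algebra (space Q) X' MX) (\<lambda>z. indicator {a} (U z)) z \<partial>Q)"
      by (rule F.real_cond_exp_int(2)[OF int, symmetric])
    also have "\<dots> = (\<integral>z. p a (X' z) \<partial>Q)"
      by (rule integral_cong_AE) (use pE[OF a] in simp_all)
    also have "\<dots> = (\<integral>\<omega>. p a (X \<omega>) \<partial>M)"
      using transfer[of "\<lambda>(x, y). p a x"] by simp
    finally show ?thesis .
  qed
  have "guessing_gain A Q = kernel_gain M X Y A p q"
    unfolding guessing_gain_def kernel_gain_def guess by (simp add: prior cong: image_cong_simp)
  then show ?thesis by (rule that[OF MK.kernel_pair_axioms])
qed

text \<open>The two sets of gains coincide: conditioning gives one inclusion, \<open>law\<close> the
  other. From here on only expectations on \<open>M\<close> occur.\<close>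

lemma maximal_leakage_eq_Sup_kernel_gain:
  assumes M: "prob_space M" and X: "X \<in> M \<rightarrow>\<^sub>M MX" and Y: "Y \<in> M \<rightarrow>\<^sub>M MY"
  shows "maximal_leakage M MX X MY Y =
    Sup {kernel_gain M X Y A p q | A p q. kernel_pair M MX X MY Y A p q}"
proof -
  let ?P = "distr M (MX \<Otimes>\<^sub>M MY) (\<lambda>\<omega>. (X \<omega>, Y \<omega>))"
  have "{guessing_gain A Q | A Q. finite A \<and> A \<noteq> {} \<and> Q \<in> leakage_laws MX MY ?P A} =
    {kernel_gain M X Y A p q | A p q. kernel_pair M MX X MY Y A p q}"
  proof (intro set_eqI iffI)
    fix g assume "g \<in> {guessing_gain A Q | A Q. finite A \<and> A \<noteq> {} \<and> Q \<in> leakage_laws MX MY ?P A}"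
    then obtain A Q where AQ: "finite A" "A \<noteq> {}" "Q \<in> leakage_laws MX MY ?P A" "g = guessing_gain A Q"
      by blast
    obtain p q where "kernel_pair M MX X MY Y A p q" "guessing_gain A Q = kernel_gain M X Y A p q"
      by (rule leakage_law_kernels[OF M X Y AQ(1-3)])
    with AQ(4) show "g \<in> {kernel_gain M X Y A p q | A p q. kernel_pair M MX X MY Y A p q}"
      by blast
  next
    fix g assume "g \<in> {kernel_gain M X Y A p q | A p q. kernel_pair M MX X MY Y A p q}"
    then obtain A p q where g: "g = kernel_gain M X Y A p q" and "kernel_pair M MX X MY Y A p q"
      by blast
    then interpret kernel_pair M MX X MY Y A p q by simp
    have "guessing_gain A law = kernel_gain M X Y A p q"
      unfolding guessing_gain_def kernel_gain_def measure_law_guess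
      by (simp add: measure_law_prior cong: image_cong_simp)
    then have "g = guessing_gain A law" using g by (simp only:)
    then show "g \<in> {guessing_gain A Q | A Q. finite A \<and> A \<noteq> {} \<and> Q \<in> leakage_laws MX MY ?P A}"
      using A law_in_leakage_laws by blast
  qed
  then show ?thesis by (simp add: maximal_leakage_def leakage_of_law_def)
qed

section \<open>Properties of maximal leakage\<close>

lemma elog_mono:
  assumes "x \<le> y"
  shows "elog x \<le> elog y"
proof (cases "x = 0 \<or> y = \<infinity>")
  case True
  then show ?thesis using assms by (auto simp: elog_def)
next
  case False
  then have fin: "x \<noteq> 0" "y \<noteq> 0" "x < \<infinity>" "y < \<infinity>"
    using assms by (auto simp: top.not_eq_extremum)
  then have "0 < enn2real x" "enn2real x \<le> enn2real y"
    using assms by (auto simp: enn2real_positive_iff zero_less_iff_neq_zero intro!: enn2real_mono)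
  then show ?thesis using fin by (auto simp: elog_def)
qed

lemma maximal_leakage_le_elog:
  assumes M: "prob_space M" and X: "X \<in> M \<rightarrow>\<^sub>M MX" and Y: "Y \<in> M \<rightarrow>\<^sub>M MY"
    and le: "\<And>A p q. kernel_pair M MX X MY Y A p q \<Longrightarrow>
      (\<integral>\<omega>. (\<Sum>a\<in>A. p a (X \<omega>) * q a (Y \<omega>)) \<partial>M) \<le> K * Max ((\<lambda>a. \<integral>\<omega>. p a (X \<omega>) \<partial>M) ` A)"
  shows "maximal_leakage M MX X MY Y \<le> elog (ennreal K)"
  unfolding maximal_leakage_eq_Sup_kernel_gain[OF M X Y]
proof (rule Sup_least)
  fix g assume "g \<in> {kernel_gain M X Y A p q | A p q. kernel_pair M MX X MY Y A p q}"
  then obtain A p q where g: "g = kernel_gain M X Y A p q" and kp: "kernel_pair M MX X MY Y A p q"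
    by blast
  have "(\<integral>\<omega>. (\<Sum>a\<in>A. p a (X \<omega>) * q a (Y \<omega>)) \<partial>M) / Max ((\<lambda>a. \<integral>\<omega>. p a (X \<omega>) \<partial>M) ` A) \<le> K"
    using le[OF kp] kernel_pair.Max_prior_pos[OF kp] by (simp add: pos_divide_le_eq)
  then show "g \<le> elog (ennreal K)"
    unfolding g kernel_gain_def by (intro elog_mono ennreal_leI)
qed

section \<open>Nonnegativity and the independent case\<close>

lemma maximal_leakage_nonneg:
  assumes M: "prob_space M" and X: "X \<in> M \<rightarrow>\<^sub>M MX" and Y: "Y \<in> M \<rightarrow>\<^sub>M MY"
  shows "0 \<le> maximal_leakage M MX X MY Y"
  unfolding maximal_leakage_eq_Sup_kernel_gain[OF M X Y]
proof (rule Sup_upper)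
  interpret prob_space M by (rule M)
  \<comment> \<open>With a one-letter alphabet the guess is always right and the prior is one, so
    the gain is the logarithm of 1.\<close>
  have "kernel_pair M MX X MY Y {0} (\<lambda>_ _. 1) (\<lambda>_ _. 1)"
    using M X Y by (simp add: kernel_pair_def kernel_pair_axioms_def finite_kernel_def)
  moreover have "kernel_gain M X Y {0} (\<lambda>_ _. 1) (\<lambda>_ _. 1) = 0"
    by (simp add: kernel_gain_def elog_def prob_space)
  ultimately show "0 \<in> {kernel_gain M X Y A p q | A p q. kernel_pair M MX X MY Y A p q}"
    by force
qed

lemma maximal_leakage_indep:
  assumes M: "prob_space M" and X: "X \<in> M \<rightarrow>\<^sub>M MX" and Y: "Y \<in> M \<rightarrow>\<^sub>M MY"
    and indep: "indep_rv M MX X MY Y"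
  shows "maximal_leakage M MX X MY Y = 0"
proof (rule antisym)
  interpret prob_space M by (rule M)
  have "maximal_leakage M MX X MY Y \<le> elog (ennreal 1)"
  proof (rule maximal_leakage_le_elog[OF M X Y])
    fix A p q assume kp: "kernel_pair M MX X MY Y A p q"
    then interpret kernel_pair M MX X MY Y A p q .
    have prod: "(\<integral>\<omega>. p a (X \<omega>) * q a (Y \<omega>) \<partial>M) = (\<integral>\<omega>. p a (X \<omega>) \<partial>M) * (\<integral>\<omega>. q a (Y \<omega>) \<partial>M)"
      if a: "a \<in> A" for a
    proof (rule indep_var_lebesgue_integral)
      \<comment> \<open>Independence is assumed for preimages under \<open>X\<close> and
        \<open>Y\<close>; preimages under a measurable function of either variable are among
        them.\<close>
      have vimage: "{(\<lambda>\<omega>. r (W \<omega>)) -` B \<inter> space M |B. B \<in> sets borel} \<subseteq> {W -` S \<inter> space M |S. S \<in> sets N}"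
        if W: "W \<in> M \<rightarrow>\<^sub>M N" and r: "r \<in> borel_measurable N" for W :: "'a \<Rightarrow> 'z" and N and r :: "'z \<Rightarrow> real"
      proof safe
        fix B :: "real set" assume "B \<in> sets borel"
        then have "r -` B \<inter> space N \<in> sets N" by (rule measurable_sets[OF r])
        moreover have "(\<lambda>\<omega>. r (W \<omega>)) -` B \<inter> space M = W -` (r -` B \<inter> space N) \<inter> space M"
          using measurable_space[OF W] by auto
        ultimately show "\<exists>S. (\<lambda>\<omega>. r (W \<omega>)) -` B \<inter> space M = W -` S \<inter> space M \<and> S \<in> sets N"
          by blast
      qed
      \<comment> \<open>Stability under intersection carries independence over to the generated
        sigma-algebras, in terms of which \<open>indep_var\<close> is phrased.\<close>
      have stable: "Int_stable {W -` B \<inter> space M |B. B \<in> sets borel}" for W :: "'a \<Rightarrow> real"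
      proof (rule Int_stableI)
        fix a b assume "a \<in> {W -` B \<inter> space M |B. B \<in> sets borel}" "b \<in> {W -` B \<inter> space M |B. B \<in> sets borel}"
        then obtain B B' where "a = W -` B \<inter> space M" "b = W -` B' \<inter> space M" "B \<in> sets borel" "B' \<in> sets borel"
          by blast
        then have "a \<inter> b = W -` (B \<inter> B') \<inter> space M" "B \<inter> B' \<in> sets borel" by auto
        then show "a \<inter> b \<in> {W -` B \<inter> space M |B. B \<in> sets borel}" by blast
      qed
      have "indep_set {(\<lambda>\<omega>. p a (X \<omega>)) -` B \<inter> space M |B. B \<in> sets borel}
          {(\<lambda>\<omega>. q a (Y \<omega>)) -` B \<inter> space M |B. B \<in> sets borel}"
      (is "indep_set ?P ?Q")
      proof -
        have P: "?P \<subseteq> {X -` S \<inter> space M |S. S \<in> sets MX}" by (rule vimage[OF X p_measurable[OF a]])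
        have Q: "?Q \<subseteq> {Y -` T \<inter> space M |T. T \<in> sets MY}" by (rule vimage[OF Y q_measurable[OF a]])
        note ind = indep[unfolded indep_rv_def]
        have "prob (E \<inter> F) = prob E * prob F" if "E \<in> ?P" "F \<in> ?Q" for E F
          by (rule indep_setD[OF ind subsetD[OF P that(1)] subsetD[OF Q that(2)]])
        moreover have "?P \<subseteq> events" by (rule subset_trans[OF P indep_setD_ev1[OF ind]])
        moreover have "?Q \<subseteq> events" by (rule subset_trans[OF Q indep_setD_ev2[OF ind]])
        ultimately show ?thesis unfolding indep_sets2_eq by simp
      qed
      then have "indep_set (sigma_sets (space M) ?P) (sigma_sets (space M) ?Q)"
        by (rule indep_set_sigma_sets[OF _ stable stable])
      then show "indep_var borel (\<lambda>\<omega>. p a (X \<omega>)) borel (\<lambda>\<omega>. q a (Y \<omega>))"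
        unfolding indep_var_eq
        using measurable_compose[OF X p_measurable[OF a]] measurable_compose[OF Y q_measurable[OF a]]
        by (intro conjI)
    qed (rule finite_kernel_expectation(1)[OF p A(1) X a],
        rule finite_kernel_expectation(1)[OF q A(1) Y a])
    let ?m = "Max ((\<lambda>a. \<integral>\<omega>. p a (X \<omega>) \<partial>M) ` A)"
    have "(\<integral>\<omega>. (\<Sum>a\<in>A. p a (X \<omega>) * q a (Y \<omega>)) \<partial>M) = (\<Sum>a\<in>A. (\<integral>\<omega>. p a (X \<omega>) \<partial>M) * (\<integral>\<omega>. q a (Y \<omega>) \<partial>M))"
      unfolding integral_kernel_products by (rule sum.cong[OF refl prod])
    \<comment> \<open>After factorization the success probability is an average of priors with
      weights summing to one, hence at most the largest prior.\<close>
    also have "\<dots> \<le> (\<Sum>a\<in>A. ?m * (\<integral>\<omega>. q a (Y \<omega>) \<partial>M))"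
      by (intro sum_mono mult_right_mono prior_le_Max Bochner_Integration.integral_nonneg
          finite_kernel_nonneg[OF q])
    also have "\<dots> = 1 * ?m"
      using finite_kernel_expectation(2)[OF q A(1) Y] by (simp add: sum_distrib_left[symmetric])
    finally show "(\<integral>\<omega>. (\<Sum>a\<in>A. p a (X \<omega>) * q a (Y \<omega>)) \<partial>M) \<le> 1 * ?m" .
  qed
  then show "maximal_leakage M MX X MY Y \<le> 0" by (simp add: elog_def zero_ereal_def)
qed (rule maximal_leakage_nonneg[OF M X Y])

section \<open>Cardinality bounds\<close>

text \<open>Each point of the countable carrier \<open>S\<close> outside the support is taken with
  probability zero, and there are countably many of them.\<close>

lemma AE_in_rv_supp:
  assumes X: "X \<in> M \<rightarrow>\<^sub>M N" and M: "prob_space M" and "discrete_rv M N X"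
  shows "AE \<omega> in M. X \<omega> \<in> rv_supp M X"
proof -
  interpret prob_space M by (rule M)
  obtain S where S: "countable S" "\<And>x. x \<in> S \<Longrightarrow> {x} \<in> sets N" "AE \<omega> in M. X \<omega> \<in> S"
    using assms(3) by (auto simp: discrete_rv_def)
  have "AE \<omega> in M. \<forall>x\<in>S - rv_supp M X. X \<omega> \<noteq> x"
  proof (subst AE_ball_countable)
    show "\<forall>x\<in>S - rv_supp M X. AE \<omega> in M. X \<omega> \<noteq> x"
    proof
      fix x assume x: "x \<in> S - rv_supp M X"
      then have "X -` {x} \<inter> space M \<in> events" "prob (X -` {x} \<inter> space M) = 0"
        using S(2) measurable_sets[OF X] measure_nonneg[of M "X -` {x} \<inter> space M"]
        by (auto simp: rv_supp_def less_le)
      then show "AE \<omega> in M. X \<omega> \<noteq> x"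
        by (intro AE_I[of _ _ "X -` {x} \<inter> space M"]) (auto simp: emeasure_eq_measure)
    qed
  qed (use S in auto)
  with S(3) show ?thesis by eventually_elim blast
qed

text \<open>A set outside the sigma-algebra has measure 0 by convention, so positive measure already
  forces measurability.\<close>

lemma rv_supp_event: "x \<in> rv_supp M X \<Longrightarrow> X -` {x} \<inter> space M \<in> sets M"
  using measure_notin_sets[of "X -` {x} \<inter> space M" M] by (force simp: rv_supp_def)

lemma log_card_finite: "finite S \<Longrightarrow> log_card S = elog (ennreal (real (card S)))"
  by (simp add: log_card_def ennreal_of_nat_eq_real_of_nat)

lemma log_card_infinite: "infinite S \<Longrightarrow> log_card S = \<infinity>"
  by (simp add: log_card_def elog_def)

lemma maximal_leakage_le_log_card_right:
  assumes M: "prob_space M" and X: "X \<in> M \<rightarrow>\<^sub>M MX" and Y: "Y \<in> M \<rightarrow>\<^sub>M MY"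
    and disc: "discrete_rv M MY Y"
  shows "maximal_leakage M MX X MY Y \<le> log_card (rv_supp M Y)"
proof (cases "finite (rv_supp M Y)")
  case True
  let ?S = "rv_supp M Y"
  show ?thesis unfolding log_card_finite[OF True]
  proof (rule maximal_leakage_le_elog[OF M X Y])
    fix A p q assume kp: "kernel_pair M MX X MY Y A p q"
    then interpret kernel_pair M MX X MY Y A p q .
    let ?m = "Max ((\<lambda>a. \<integral>\<omega>. p a (X \<omega>) \<partial>M) ` A)"
    have int: "integrable M (\<lambda>\<omega>. p a (X \<omega>) * q a y)" if "a \<in> A" for a y
      using finite_kernel_expectation(1)[OF p A(1) X that] by simp
    \<comment> \<open>The term with \<open>y = Y \<omega>\<close> is the integrand on the left and
      the others are nonnegative. On the right \<open>q a y\<close> is a constant, so only the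
      priors are left to integrate.\<close>
    have "(\<integral>\<omega>. (\<Sum>a\<in>A. p a (X \<omega>) * q a (Y \<omega>)) \<partial>M) \<le> (\<integral>\<omega>. (\<Sum>y\<in>?S. \<Sum>a\<in>A. p a (X \<omega>) * q a y) \<partial>M)"
    proof (rule integral_mono_AE)
      show "AE \<omega> in M. (\<Sum>a\<in>A. p a (X \<omega>) * q a (Y \<omega>)) \<le> (\<Sum>y\<in>?S. \<Sum>a\<in>A. p a (X \<omega>) * q a y)"
        using AE_in_rv_supp[OF Y M disc]
      proof eventually_elim
        case (elim \<omega>)
        then show ?case
          by (intro member_le_sum[where f="\<lambda>y. \<Sum>a\<in>A. p a (X \<omega>) * q a y"])
            (auto intro!: sum_nonneg mult_nonneg_nonneg finite_kernel_nonneg[OF p]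
              finite_kernel_nonneg[OF q] True)
      qed
    qed (use int integrable_kernel_product in auto)
    also have "\<dots> = (\<Sum>y\<in>?S. \<Sum>a\<in>A. (\<integral>\<omega>. p a (X \<omega>) \<partial>M) * q a y)"
      using int by (simp add: Bochner_Integration.integral_sum)
    also have "\<dots> \<le> (\<Sum>y\<in>?S. \<Sum>a\<in>A. ?m * q a y)"
      by (intro sum_mono mult_right_mono prior_le_Max finite_kernel_nonneg[OF q])
    also have "\<dots> = real (card ?S) * ?m"
      by (simp add: sum_distrib_left[symmetric] finite_kernel_sum[OF q])
    finally show "(\<integral>\<omega>. (\<Sum>a\<in>A. p a (X \<omega>) * q a (Y \<omega>)) \<partial>M) \<le> real (card ?S) * ?m" .
  qed
qed (simp add: log_card_infinite)

lemma maximal_leakage_le_log_card_left: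
  assumes M: "prob_space M" and X: "X \<in> M \<rightarrow>\<^sub>M MX" and Y: "Y \<in> M \<rightarrow>\<^sub>M MY"
    and disc: "discrete_rv M MX X"
  shows "maximal_leakage M MX X MY Y \<le> log_card (rv_supp M X)"
proof (cases "finite (rv_supp M X)")
  case True
  let ?S = "rv_supp M X"
  show ?thesis unfolding log_card_finite[OF True]
  proof (rule maximal_leakage_le_elog[OF M X Y])
    fix A p q assume kp: "kernel_pair M MX X MY Y A p q"
    then interpret kernel_pair M MX X MY Y A p q .
    let ?m = "Max ((\<lambda>a. \<integral>\<omega>. p a (X \<omega>) \<partial>M) ` A)"
    let ?I = "\<lambda>x. indicator (X -` {x} \<inter> space M) :: _ \<Rightarrow> real"
    \<comment> \<open>\<open>t x\<close> is the success probability of the best guess of the letter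
      once \<open>x\<close> is known. It is integrated only as a constant at the finitely many
      points of \<open>?S\<close>, so its measurability never arises.\<close>
    define t where "t x = Max ((\<lambda>a. p a x) ` A)" for x
    have p_le_t: "p a x \<le> t x" if "a \<in> A" for a x
      using that A by (simp add: t_def)
    have "\<exists>a. a \<in> A \<and> t x = p a x" for x
    proof -
      have "t x \<in> (\<lambda>a. p a x) ` A" unfolding t_def by (rule Max_in) (use A in auto)
      then show ?thesis by blast
    qed
    then obtain best where best: "\<And>x. best x \<in> A" "\<And>x. t x = p (best x) x" by metis
    have t0: "0 \<le> t x" for x using best finite_kernel_nonneg[OF p] by metis
    have int: "integrable M (\<lambda>\<omega>. ?I x \<omega> * t x)" if "x \<in> ?S" for x
      using rv_supp_event[OF that] by (intro integrable_mult_left integrable_real_indicator)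
        (simp_all add: emeasure_eq_measure)
    have "(\<integral>\<omega>. (\<Sum>a\<in>A. p a (X \<omega>) * q a (Y \<omega>)) \<partial>M) \<le> (\<integral>\<omega>. (\<Sum>x\<in>?S. ?I x \<omega> * t x) \<partial>M)"
    proof (rule integral_mono_AE)
      show "AE \<omega> in M. (\<Sum>a\<in>A. p a (X \<omega>) * q a (Y \<omega>)) \<le> (\<Sum>x\<in>?S. ?I x \<omega> * t x)"
        using AE_in_rv_supp[OF X M disc] AE_space
      proof eventually_elim
        case (elim \<omega>)
        have "(\<Sum>a\<in>A. p a (X \<omega>) * q a (Y \<omega>)) \<le> (\<Sum>a\<in>A. t (X \<omega>) * q a (Y \<omega>))"
          by (intro sum_mono mult_right_mono p_le_t finite_kernel_nonneg[OF q])
        also have "\<dots> = ?I (X \<omega>) \<omega> * t (X \<omega>)"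
          using elim by (simp add: sum_distrib_left[symmetric] finite_kernel_sum[OF q])
        also have "\<dots> \<le> (\<Sum>x\<in>?S. ?I x \<omega> * t x)"
          using elim by (intro member_le_sum[where f="\<lambda>x. ?I x \<omega> * t x"]) (auto simp: t0 True)
        finally show ?case .
      qed
    qed (use int integrable_kernel_product in auto)
    also have "\<dots> = (\<Sum>x\<in>?S. \<integral>\<omega>. ?I x \<omega> * t x \<partial>M)"
      using int by (rule Bochner_Integration.integral_sum)
    also have "\<dots> \<le> (\<Sum>x\<in>?S. ?m)"
    proof (rule sum_mono)
      fix x assume x: "x \<in> ?S"
      \<comment> \<open>On the event \<open>X \<omega> = x\<close> the value \<open>t x\<close>
        equals \<open>p (best x) (X \<omega>)\<close>; elsewhere the left integrand vanishes. The
        best letter may differ from one \<open>x\<close> to another, but each is bounded by the same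
        largest prior.\<close>
      have "(\<integral>\<omega>. ?I x \<omega> * t x \<partial>M) \<le> (\<integral>\<omega>. p (best x) (X \<omega>) \<partial>M)"
        using int[OF x] finite_kernel_expectation(1)[OF p A(1) X best(1)]
        by (rule integral_mono)
          (auto simp: best(2) indicator_def finite_kernel_nonneg[OF p best(1)])
      also have "\<dots> \<le> ?m" by (rule prior_le_Max[OF best(1)])
      finally show "(\<integral>\<omega>. ?I x \<omega> * t x \<partial>M) \<le> ?m" .
    qed
    finally show "(\<integral>\<omega>. (\<Sum>a\<in>A. p a (X \<omega>) * q a (Y \<omega>)) \<partial>M) \<le> real (card ?S) * ?m" by simp
  qed
qed (simp add: log_card_infinite)

section \<open>Data processing\<close>

text \<open>An observer of \<open>Y\<close> can imitate a guess based on \<open>Z\<close> by drawing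
  it from its conditional law given \<open>Y\<close>. The letter kernel \<open>p\<close> is kept, so
  the denominator of the gain stays the same.\<close>

lemma kernel_gain_conditioning_right:
  assumes kp: "kernel_pair M MX X MZ Z A p q" and Y[measurable]: "Y \<in> M \<rightarrow>\<^sub>M MY"
    and mc: "markov_chain3 M MX X MY Y MZ Z"
  obtains q' where "kernel_pair M MX X MY Y A p q'" "kernel_gain M X Y A p q' = kernel_gain M X Z A p q"
proof -
  interpret K: kernel_pair M MX X MZ Z A p q by (rule kp)
  have q_meas: "(\<lambda>\<omega>. q a (Z \<omega>)) \<in> borel_measurable M" if "a \<in> A" for a
    by (rule measurable_compose[OF K.Y K.q_measurable[OF that]])
  obtain q' where q': "finite_kernel MY A q'" and q'E: "\<And>a. a \<in> A \<Longrightarrow>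
      AE \<omega> in M. real_cond_exp M (vimage_algebra (space M) Y MY) (\<lambda>\<omega>. q a (Z \<omega>)) \<omega> = q' a (Y \<omega>)"
    by (rule K.exists_conditional_kernel[OF Y K.A(1), of "\<lambda>a \<omega>. q a (Z \<omega>)"])
      (use q_meas finite_kernel_nonneg[OF K.q] finite_kernel_sum[OF K.q] in auto)
  interpret K': kernel_pair M MX X MY Y A p q'
    using K.prob_space_axioms K.X Y K.A K.p q' by (simp add: kernel_pair_def kernel_pair_axioms_def)
  \<comment> \<open>The chain is reversed so that the conditional expectation falls on the function
    of \<open>Z\<close>.\<close>
  have ci: "cond_indep_var M MZ Z MY Y MX X"
    using mc by (auto simp: markov_chain3_def intro: cond_indep_var_commute)
  have "(\<integral>\<omega>. p a (X \<omega>) * q' a (Y \<omega>) \<partial>M) = (\<integral>\<omega>. p a (X \<omega>) * q a (Z \<omega>) \<partial>M)" if a: "a \<in> A" for a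
  proof -
    note [measurable] = K.X K.Y K.p_measurable[OF a] K.q_measurable[OF a] K'.q_measurable[OF a]
    have "(\<integral>\<omega>. q a (Z \<omega>) * p a (X \<omega>) \<partial>M) =
      (\<integral>\<omega>. real_cond_exp M (vimage_algebra (space M) Y MY) (\<lambda>\<omega>. q a (Z \<omega>)) \<omega> * p a (X \<omega>) \<partial>M)"
      by (rule K.cond_indep_var_integral[OF ci K.Y Y K.X K.q_measurable[OF a] _ K.p_measurable[OF a]])
        (simp add: finite_kernel_nonneg[OF K.q a] finite_kernel_le_1[OF K.q K.A(1) a])
    also have "\<dots> = (\<integral>\<omega>. p a (X \<omega>) * q' a (Y \<omega>) \<partial>M)"
    proof (rule integral_cong_AE)
      show "AE \<omega> in M. real_cond_exp M (vimage_algebra (space M) Y MY) (\<lambda>\<omega>. q a (Z \<omega>)) \<omega> * p a (X \<omega>) =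
        p a (X \<omega>) * q' a (Y \<omega>)"
        using q'E[OF a] by eventually_elim simp
    qed measurable
    finally show ?thesis by (simp add: mult.commute)
  qed
  then have "kernel_gain M X Y A p q' = kernel_gain M X Z A p q"
    unfolding kernel_gain_def K.integral_kernel_products K'.integral_kernel_products by simp
  then show ?thesis by (rule that[OF K'.kernel_pair_axioms])
qed

text \<open>Averaging \<open>p a (X \<omega>)\<close> given \<open>Y\<close> turns a letter
  generated from \<open>X\<close> into one generated from \<open>Y\<close>, with the same joint
  behaviour towards \<open>Z\<close>.\<close>

lemma kernel_gain_conditioning_left:
  assumes kp: "kernel_pair M MX X MZ Z A p q" and Y[measurable]: "Y \<in> M \<rightarrow>\<^sub>M MY"
    and mc: "markov_chain3 M MX X MY Y MZ Z"
  obtains p' where "kernel_pair M MY Y MZ Z A p' q" "kernel_gain M Y Z A p' q = kernel_gain M X Z A p q"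
proof -
  interpret K: kernel_pair M MX X MZ Z A p q by (rule kp)
  have p_meas: "(\<lambda>\<omega>. p a (X \<omega>)) \<in> borel_measurable M" if "a \<in> A" for a
    by (rule measurable_compose[OF K.X K.p_measurable[OF that]])
  obtain p' where p': "finite_kernel MY A p'" and p'E: "\<And>a. a \<in> A \<Longrightarrow>
      AE \<omega> in M. real_cond_exp M (vimage_algebra (space M) Y MY) (\<lambda>\<omega>. p a (X \<omega>)) \<omega> = p' a (Y \<omega>)"
    by (rule K.exists_conditional_kernel[OF Y K.A(1), of "\<lambda>a \<omega>. p a (X \<omega>)"])
      (use p_meas finite_kernel_nonneg[OF K.p] finite_kernel_sum[OF K.p] in auto)
  interpret K': kernel_pair M MY Y MZ Z A p' q
    using K.prob_space_axioms K.Y Y K.A K.q p' by (simp add: kernel_pair_def kernel_pair_axioms_def)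
  interpret F: finite_measure_subalgebra M "vimage_algebra (space M) Y MY"
    by (rule K.finite_measure_subalgebra_vimage[OF Y])
  have ci: "cond_indep_var M MX X MY Y MZ Z"
    using mc by (simp add: markov_chain3_def)
  have "(\<integral>\<omega>. p' a (Y \<omega>) * q a (Z \<omega>) \<partial>M) = (\<integral>\<omega>. p a (X \<omega>) * q a (Z \<omega>) \<partial>M)" if a: "a \<in> A" for a
  proof -
    note [measurable] = K.X K.Y K.p_measurable[OF a] K.q_measurable[OF a] K'.p_measurable[OF a]
    have "(\<integral>\<omega>. p a (X \<omega>) * q a (Z \<omega>) \<partial>M) =
      (\<integral>\<omega>. real_cond_exp M (vimage_algebra (space M) Y MY) (\<lambda>\<omega>. p a (X \<omega>)) \<omega> * q a (Z \<omega>) \<partial>M)"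
      by (rule K.cond_indep_var_integral[OF ci K.X Y K.Y K.p_measurable[OF a] _ K.q_measurable[OF a]])
        (simp add: finite_kernel_nonneg[OF K.p a] finite_kernel_le_1[OF K.p K.A(1) a])
    also have "\<dots> = (\<integral>\<omega>. p' a (Y \<omega>) * q a (Z \<omega>) \<partial>M)"
    proof (rule integral_cong_AE)
      show "AE \<omega> in M. real_cond_exp M (vimage_algebra (space M) Y MY) (\<lambda>\<omega>. p a (X \<omega>)) \<omega> * q a (Z \<omega>) =
        p' a (Y \<omega>) * q a (Z \<omega>)"
        using p'E[OF a] by eventually_elim simp
    qed measurable
    finally show ?thesis by simp
  qed
  \<comment> \<open>The letter kernel has changed, so the priors in the denominator must be compared
    as well; they agree by the tower property.\<close>
  moreover have "(\<integral>\<omega>. p' a (Y \<omega>) \<partial>M) = (\<integral>\<omega>. p a (X \<omega>) \<partial>M)" if a: "a \<in> A" for a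
  proof -
    have "(\<integral>\<omega>. p' a (Y \<omega>) \<partial>M) =
        (\<integral>\<omega>. real_cond_exp M (vimage_algebra (space M) Y MY) (\<lambda>\<omega>. p a (X \<omega>)) \<omega> \<partial>M)"
      using p'E[OF a] measurable_compose[OF Y K'.p_measurable[OF a]]
      by (intro integral_cong_AE) auto
    also have "\<dots> = (\<integral>\<omega>. p a (X \<omega>) \<partial>M)"
      by (rule F.real_cond_exp_int(2)[OF K.finite_kernel_expectation(1)[OF K.p K.A(1) K.X a]])
    finally show ?thesis .
  qed
  ultimately have "kernel_gain M Y Z A p' q = kernel_gain M X Z A p q"
    unfolding kernel_gain_def K.integral_kernel_products K'.integral_kernel_products
    by (simp cong: image_cong_simp)
  then show ?thesis by (rule that[OF K'.kernel_pair_axioms])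
qed

lemma maximal_leakage_data_processing:
  assumes M: "prob_space M" and X: "X \<in> M \<rightarrow>\<^sub>M MX" and Y: "Y \<in> M \<rightarrow>\<^sub>M MY" and Z: "Z \<in> M \<rightarrow>\<^sub>M MZ"
    and mc: "markov_chain3 M MX X MY Y MZ Z"
  shows "maximal_leakage M MX X MZ Z \<le> maximal_leakage M MX X MY Y"
    and "maximal_leakage M MX X MZ Z \<le> maximal_leakage M MY Y MZ Z"
proof -
  show "maximal_leakage M MX X MZ Z \<le> maximal_leakage M MX X MY Y"
    unfolding maximal_leakage_eq_Sup_kernel_gain[OF M X Z] maximal_leakage_eq_Sup_kernel_gain[OF M X Y]
  proof (intro Sup_subset_mono subsetI)
    fix g assume "g \<in> {kernel_gain M X Z A p q | A p q. kernel_pair M MX X MZ Z A p q}"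
    then obtain A p q where g: "g = kernel_gain M X Z A p q" and kp: "kernel_pair M MX X MZ Z A p q"
      by blast
    obtain q' where "kernel_pair M MX X MY Y A p q'" "kernel_gain M X Y A p q' = kernel_gain M X Z A p q"
      by (rule kernel_gain_conditioning_right[OF kp Y mc])
    then show "g \<in> {kernel_gain M X Y A p q | A p q. kernel_pair M MX X MY Y A p q}"
      unfolding g by force
  qed
  show "maximal_leakage M MX X MZ Z \<le> maximal_leakage M MY Y MZ Z"
    unfolding maximal_leakage_eq_Sup_kernel_gain[OF M X Z] maximal_leakage_eq_Sup_kernel_gain[OF M Y Z]
  proof (intro Sup_subset_mono subsetI)
    fix g assume "g \<in> {kernel_gain M X Z A p q | A p q. kernel_pair M MX X MZ Z A p q}"
    then obtain A p q where g: "g = kernel_gain M X Z A p q" and kp: "kernel_pair M MX X MZ Z A p q"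
      by blast
    obtain p' where "kernel_pair M MY Y MZ Z A p' q" "kernel_gain M Y Z A p' q = kernel_gain M X Z A p q"
      by (rule kernel_gain_conditioning_left[OF kp Y mc])
    then show "g \<in> {kernel_gain M Y Z A p q | A p q. kernel_pair M MY Y MZ Z A p q}"
      unfolding g by force
  qed
qed

theorem lemma1:
  fixes M :: "'w measure"
    and MX :: "'a measure" and X :: "'w \<Rightarrow> 'a"
    and MY :: "'b measure" and Y :: "'w \<Rightarrow> 'b"
  assumes "prob_space M"
    and "X \<in> M \<rightarrow>\<^sub>M MX"
    and "Y \<in> M \<rightarrow>\<^sub>M MY"
  shows "(\<forall>(MZ :: 'c measure) (Z :: 'w \<Rightarrow> 'c).
            Z \<in> M \<rightarrow>\<^sub>M MZ \<and> markov_chain3 M MX X MY Y MZ Z \<longrightarrow>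
            maximal_leakage M MX X MZ Z \<le>
              min (maximal_leakage M MX X MY Y) (maximal_leakage M MY Y MZ Z))
       \<and> (discrete_rv M MY Y \<longrightarrow> maximal_leakage M MX X MY Y \<le> log_card (rv_supp M Y))
       \<and> (discrete_rv M MX X \<longrightarrow> maximal_leakage M MX X MY Y \<le> log_card (rv_supp M X))
       \<and> maximal_leakage M MX X MY Y \<ge> 0
       \<and> (indep_rv M MX X MY Y \<longrightarrow> maximal_leakage M MX X MY Y = 0)"
  using maximal_leakage_data_processing[OF assms] maximal_leakage_le_log_card_right[OF assms]
    maximal_leakage_le_log_card_left[OF assms] maximal_leakage_nonneg[OF assms]
    maximal_leakage_indep[OF assms]
  by (intro conjI allI impI) auto

end
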